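(* For every unitary operator $U$ on $\mathbb{C}^5$ with five distinct eigenvalues, $\Omega_2(U)=\Sigma_2(U)$. Thus, for every such $U$, $\Lambda_2(U)=\Omega_2(U)$.
   Context: Let $T$ be an operator on $\mathbb{C}^N$ with eigenvalues $\lambda_1,\dots,\lambda_N$ (listed with multiplicity), and let $1\le k\le N$. $\Lambda_k(T)$ is the $k$th (higher-rank) numerical range: the set of $\lambda\in\mathbb{C}$ such that $PTP=\lambda P$ for some orthogonal projection $P$ of rank $k$. $\Omega_k(T)=\bigcap_{S}\operatorname{conv}\{\lambda_j: j\in S\}$, where $S$ runs over all subsets of $\{1,\dots,N\}$ with exactly $N-k+1$ elements. For unitary $U$ on $\mathbb{C}^N$ with eigenvalues $\lambda_1,\dots,\lambda_N$, $\Sigma_k(U)$ is the set of all $\lambda\in\mathbb{C}$ for which there exist $t_1,\dots,t_N\ge 0$ with $\sum_j t_j=1$ and $\lambda=\sum_j t_j\lambda_j$, and complex numbers $\alpha_{ij}$ ($1\le i\le k$, $1\le j\le N$) such that $|\alpha_{ij}|=\sqrt{t_j}$ for all $i,j$, and whenever $i\ne i'$ both $\sum_j\alpha_{ij}\overline{\alpha_{i'j}}=0$ and $\sum_j\lambda_j\alpha_{ij}\overline{\alpha_{i'j}}=0$. *)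

theory Defs
  imports
    "HOL-Analysis.Convex"
    "HOL-Combinatorics.Permutations"
    "Jordan_Normal_Form.Spectral_Radius"
    "Jordan_Normal_Form.DL_Rank"
begin

text \<open>Operators on \<open>\<complex>\<^sup>N\<close> are given by their matrices in \<^term>\<open>carrier_mat N N\<close>
  with respect to the standard basis. Indices run over \<open>{0..<N}\<close> rather than \<open>{1..N}\<close>.\<close>

definition unitary_mat :: "complex mat \<Rightarrow> bool" where
  "unitary_mat U \<longleftrightarrow> square_mat U \<and>
     inverts_mat U (mat_adjoint U) \<and> inverts_mat (mat_adjoint U) U"

definition orthogonal_projection :: "nat \<Rightarrow> complex mat \<Rightarrow> bool" where
  "orthogonal_projection N P \<longleftrightarrow> P \<in> carrier_mat N N \<and> P * P = P \<and> mat_adjoint P = P"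

definition higher_rank_numerical_range :: "nat \<Rightarrow> complex mat \<Rightarrow> complex set" where
  "higher_rank_numerical_range k T =
     {l. \<exists>P. orthogonal_projection (dim_row T) P \<and> vec_space.rank (dim_row T) P = k \<and>
             P * T * P = l \<cdot>\<^sub>m P}"

text \<open>A listing of the eigenvalues with algebraic multiplicity, in an arbitrary order. Each set
  defined from it below does not depend on the order; see \<open>Omega_list_cong\<close> and
  \<open>Sigma_list_cong\<close>.\<close>

definition eigvals :: "complex mat \<Rightarrow> complex list" where
  "eigvals T = (SOME es. char_poly T = (\<Prod>e\<leftarrow>es. [:- e, 1:]))"

text \<open>Subtraction is on natural numbers: the definition is meant for \<open>1 \<le> k \<le> N\<close>,
  where \<open>N = length es\<close>.\<close>

definition Omega_list :: "nat \<Rightarrow> complex list \<Rightarrow> complex set" where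
  "Omega_list k es =
     (\<Inter>S \<in> {S. S \<subseteq> {..<length es} \<and> card S = length es - k + 1}. convex hull ((\<lambda>j. es ! j) ` S))"

definition Sigma_list :: "nat \<Rightarrow> complex list \<Rightarrow> complex set" where
  "Sigma_list k es =
     {l. \<exists>(t :: nat \<Rightarrow> real) (\<alpha> :: nat \<Rightarrow> nat \<Rightarrow> complex).
           (\<forall>j<length es. t j \<ge> 0) \<and>
           (\<Sum>j<length es. t j) = 1 \<and>
           l = (\<Sum>j<length es. of_real (t j) * es ! j) \<and>
           (\<forall>i<k. \<forall>j<length es. cmod (\<alpha> i j) = sqrt (t j)) \<and>
           (\<forall>i<k. \<forall>i'<k. i \<noteq> i' \<longrightarrow>
              (\<Sum>j<length es. \<alpha> i j * cnj (\<alpha> i' j)) = 0 \<and>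
              (\<Sum>j<length es. es ! j * \<alpha> i j * cnj (\<alpha> i' j)) = 0)}"

definition Omega_range :: "nat \<Rightarrow> complex mat \<Rightarrow> complex set" where
  "Omega_range k T = Omega_list k (eigvals T)"

definition Sigma_range :: "nat \<Rightarrow> complex mat \<Rightarrow> complex set" where
  "Sigma_range k U = Sigma_list k (eigvals U)"

lemma eigvals:
  assumes "T \<in> carrier_mat N N"
  shows char_poly_eigvals: "char_poly T = (\<Prod>e\<leftarrow>eigvals T. [:- e, 1:])"
    and length_eigvals: "length (eigvals T) = N"
proof -
  obtain es where "char_poly T = (\<Prod>e\<leftarrow>es. [:- e, 1:])"
    using char_poly_factorized[OF assms] by auto
  then show *: "char_poly T = (\<Prod>e\<leftarrow>eigvals T. [:- e, 1:])"
    unfolding eigvals_def by (rule someI)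
  have "degree (\<Prod>e\<leftarrow>es. [:- e, 1:]) = length es" for es :: "complex list"
  proof (induction es)
    case (Cons a es)
    have "(\<Prod>e\<leftarrow>es. [:- e, 1:]) \<noteq> 0" by (auto simp: prod_list_zero_iff)
    then show ?case using Cons by (simp add: degree_mult_eq del: mult_pCons_left)
  qed simp
  then show "length (eigvals T) = N"
    using degree_monic_char_poly[OF assms] * by metis
qed

lemma set_eigvals:
  assumes "T \<in> carrier_mat N N"
  shows "set (eigvals T) = spectrum T"
  unfolding spectrum_def
  by (auto simp: eigenvalue_root_char_poly[OF assms] char_poly_eigvals[OF assms]
      poly_prod_list prod_list_zero_iff)

lemma mset_eq_imp_permutes:
  assumes "mset es = mset es'"
  obtains p where "p permutes {..<length es}" "length es' = length es"
    "\<forall>j<length es. es' ! j = es ! p j"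
proof -
  from assms obtain p where p: "p permutes {..<length es}" "permute_list p es = es'"
    by (metis mset_eq_permutation)
  show ?thesis
  proof (rule that)
    show "p permutes {..<length es}" by (rule p(1))
    show "length es' = length es" unfolding p(2)[symmetric] by simp
    show "\<forall>j<length es. es' ! j = es ! p j"
      unfolding p(2)[symmetric] using permute_list_nth[OF p(1)] by blast
  qed
qed

lemma Omega_list_subset:
  assumes "mset es = mset es'"
  shows "Omega_list k es \<subseteq> Omega_list k es'"
proof -
  obtain p where p: "p permutes {..<length es}" "length es' = length es"
    "\<forall>j<length es. es' ! j = es ! p j"
    by (rule mset_eq_imp_permutes[OF assms])
  have "z \<in> convex hull ((\<lambda>j. es' ! j) ` S)"
    if z: "z \<in> Omega_list k es"
      and S: "S \<subseteq> {..<length es'}" "card S = length es' - k + 1" for z S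
  proof -
    have "p ` S \<subseteq> p ` {..<length es}"
      by (rule image_mono) (use S(1) p(2) in simp)
    then have 1: "p ` S \<subseteq> {..<length es}"
      by (simp only: permutes_image[OF p(1)])
    have "inj_on p S"
      by (rule inj_on_subset[OF permutes_inj[OF p(1)]]) simp
    then have 2: "card (p ` S) = length es - k + 1"
      using S(2) p(2) by (simp add: card_image)
    have "(\<lambda>j. es ! j) ` (p ` S) = (\<lambda>j. es' ! j) ` S"
      unfolding image_image by (rule image_cong) (use S(1) p(2,3) in auto)
    moreover have "z \<in> convex hull ((\<lambda>j. es ! j) ` (p ` S))"
      using z 1 2 unfolding Omega_list_def by blast
    ultimately show ?thesis by simp
  qed
  then show ?thesis
    unfolding Omega_list_def[of k es'] by (intro subsetI INT_I) simp
qed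

lemma Omega_list_cong: "mset es = mset es' \<Longrightarrow> Omega_list k es = Omega_list k es'"
  by (intro equalityI Omega_list_subset) simp_all

lemma Sigma_list_subset:
  assumes "mset es = mset es'"
  shows "Sigma_list k es \<subseteq> Sigma_list k es'"
proof
  obtain p where p: "p permutes {..<length es}" "length es' = length es"
    "\<forall>j<length es. es' ! j = es ! p j"
    by (rule mset_eq_imp_permutes[OF assms])
  have less: "p j < length es" if "j < length es" for j
    using that permutes_in_image[OF p(1), of j] by simp
  have sum: "(\<Sum>j<length es. f (p j) (es' ! j)) = (\<Sum>j<length es. f j (es ! j))"
    for f :: "nat \<Rightarrow> complex \<Rightarrow> 'b::comm_monoid_add"
    using sum.permute[OF p(1), of "\<lambda>j. f j (es ! j)"] p(3) by (simp add: o_def)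
  fix z assume "z \<in> Sigma_list k es"
  then obtain t \<alpha> where *:
    "\<forall>j<length es. t j \<ge> (0::real)" "(\<Sum>j<length es. t j) = 1"
    "z = (\<Sum>j<length es. of_real (t j) * es ! j)"
    "\<forall>i<k. \<forall>j<length es. cmod (\<alpha> i j) = sqrt (t j)"
    "\<forall>i<k. \<forall>i'<k. i \<noteq> i' \<longrightarrow>
       (\<Sum>j<length es. \<alpha> i j * cnj (\<alpha> i' j)) = 0 \<and>
       (\<Sum>j<length es. es ! j * \<alpha> i j * cnj (\<alpha> i' j)) = 0"
    unfolding Sigma_list_def by blast
  define t' where "t' = t \<circ> p"
  define \<alpha>' where "\<alpha>' i = \<alpha> i \<circ> p" for i
  have "\<forall>j<length es. t' j \<ge> 0" "\<forall>i<k. \<forall>j<length es. cmod (\<alpha>' i j) = sqrt (t' j)"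
    using *(1,4) less by (simp_all add: t'_def \<alpha>'_def)
  moreover have "(\<Sum>j<length es. t' j) = 1"
    using sum[of "\<lambda>j e. t j"] *(2) by (simp add: t'_def)
  moreover have "z = (\<Sum>j<length es. of_real (t' j) * es' ! j)"
    using sum[of "\<lambda>j e. of_real (t j) * e"] *(3) by (simp add: t'_def)
  moreover have "(\<Sum>j<length es. \<alpha>' i j * cnj (\<alpha>' i' j)) = 0 \<and>
      (\<Sum>j<length es. es' ! j * \<alpha>' i j * cnj (\<alpha>' i' j)) = 0"
    if "i < k" "i' < k" "i \<noteq> i'" for i i'
    using sum[of "\<lambda>j e. \<alpha> i j * cnj (\<alpha> i' j)"] sum[of "\<lambda>j e. e * \<alpha> i j * cnj (\<alpha> i' j)"]
      *(5) that by (simp add: \<alpha>'_def)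
  ultimately show "z \<in> Sigma_list k es'"
    unfolding Sigma_list_def p(2)
    by (intro CollectI exI[of _ t'] exI[of _ \<alpha>'] conjI allI impI) auto
qed

lemma Sigma_list_cong: "mset es = mset es' \<Longrightarrow> Sigma_list k es = Sigma_list k es'"
  by (intro equalityI Sigma_list_subset) simp_all

end

theory Submission
  imports Defs "HOL-Analysis.Line_Segment"
begin

text \<open>Only the inclusion of \<open>\<Omega>\<^sub>2\<close> in \<open>\<Sigma>\<^sub>2\<close> is deep. Write \<open>A\<close> for the set of the five eigenvalues and fix
  \<open>z \<in> \<Omega>\<^sub>2\<close>. By Lagrange interpolation, \<open>v\<^sub>x = (\<alpha> x + \<beta>) x / (\<Prod>y \<in> A - {x}. x - y)\<close> satisfies
  \<open>(\<Sum>x\<in>A. v\<^sub>x) = 0\<close> and \<open>(\<Sum>x\<in>A. x v\<^sub>x) = 0\<close>, so it suffices to choose \<open>\<alpha>, \<beta>\<close> such that the weights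
  \<open>t\<^sub>x = \<bar>v\<^sub>x\<bar>\<close> have barycentre \<open>z\<close>. On the unit circle, the functions \<open>\<bar>\<alpha> x + \<beta>\<bar>\<^sup>2\<close> are exactly the
  nonnegative affine ones. With \<open>w\<^sub>x = 1 / (\<Prod>y \<in> A - {x}. \<bar>x - y\<bar>)\<close>, minimise the convex functional
  \<open>\<Sum>x\<in>A. w\<^sub>x h(x)\<^bsup>3/2\<^esup>\<close> over the affine functions \<open>h\<close> with \<open>h(z) = 1\<close> that are nonnegative on the
  circle. At an interior minimum, stationarity says that \<open>\<Sum>x\<in>A. w\<^sub>x h(x)\<^bsup>1/2\<^esup> (x - z) = 0\<close>, as wanted.
  At a boundary point \<open>h\<close> is a multiple of \<open>\<bar>x - p\<bar>\<^sup>2\<close> with \<open>\<bar>p\<bar> = 1\<close>, the barycentre of the weights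
  lies on a side of the inner pentagon, whose line does not separate \<open>z\<close> from \<open>p\<close>, and this forces the
  same conclusion.

  The inclusions \<open>\<Sigma>\<^sub>2 \<subseteq> \<Lambda>\<^sub>2 \<subseteq> \<Omega>\<^sub>2\<close> are linear algebra in an orthonormal eigenbasis: the rows of
  \<open>\<alpha>\<^sub>i\<^sub>j\<close> span the range of a projection, and a two-dimensional range contains a nonzero vector that is
  orthogonal to any given eigenvector.\<close>

unbundle no vec_syntax
hide_const (open) Finite_Cartesian_Product.mat Finite_Cartesian_Product.vec Finite_Cartesian_Product.row

section \<open>Auxiliary inequalities and interpolation\<close>

text \<open>Tangent-line inequality for the convex function t^(3/2), with the tangent at
  \<open>b\<close>. In terms of the square roots \<open>x\<close> and \<open>y\<close>, the gap is
  half of \<open>(y - x)^2 * (y + 2 * x)\<close>.\<close>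

lemma diff_three_halves_le:
  fixes a b :: real
  assumes "a \<ge> 0" "b \<ge> 0"
  shows "b * sqrt b - a * sqrt a \<le> 3 / 2 * sqrt b * (b - a)"
proof -
  define x y where "x = sqrt a" "y = sqrt b"
  have xy: "a = x\<^sup>2" "b = y\<^sup>2" "x \<ge> 0" "y \<ge> 0" using assms by (auto simp: x_y_def)
  have "0 \<le> (y - x)\<^sup>2 * (y + 2 * x)" using xy by simp
  also have "\<dots> = 2 * (3 / 2 * y * (y\<^sup>2 - x\<^sup>2) - (y\<^sup>2 * y - x\<^sup>2 * x))"
    by (simp add: power2_eq_square field_simps)
  finally have "y\<^sup>2 * y - x\<^sup>2 * x \<le> 3 / 2 * y * (y\<^sup>2 - x\<^sup>2)" by simp
  then show ?thesis using xy by simp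
qed

text \<open>On the compact set where \<open>e \<le> 0\<close>, if nonempty, \<open>h\<close> has a
  positive minimum and \<open>e\<close> a lower bound, so small multiples of \<open>e\<close> cannot
  outweigh \<open>h\<close>; elsewhere both terms are nonnegative.\<close>

lemma compact_perturb_nonneg:
  fixes h e :: "'a::topological_space \<Rightarrow> real"
  assumes "compact C" "continuous_on C h" "continuous_on C e"
    and h: "\<And>x. x \<in> C \<Longrightarrow> h x \<ge> 0"
    and pos: "\<And>x. x \<in> C \<Longrightarrow> h x = 0 \<Longrightarrow> e x > 0"
  obtains \<epsilon> where "\<epsilon> > 0" "\<And>\<delta> x. 0 \<le> \<delta> \<Longrightarrow> \<delta> \<le> \<epsilon> \<Longrightarrow> x \<in> C \<Longrightarrow> h x + \<delta> * e x \<ge> 0"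
proof -
  define D where "D = C \<inter> e -` {..0}"
  have e0: "closedin (top_of_set C) D"
    unfolding D_def by (rule continuous_closedin_preimage[OF assms(3)]) simp
  have D: "compact D" "D \<subseteq> C"
    using closedin_compact[OF assms(1) e0] by (auto simp: D_def)
  show ?thesis
  proof (cases "D = {}")
    case True
    then have "e x > 0" if "x \<in> C" for x using that by (force simp: D_def)
    then show ?thesis using h by (intro that[of 1]) (auto intro!: add_nonneg_nonneg simp: less_imp_le)
  next
    case False
    obtain m where m: "m \<in> D" "\<And>x. x \<in> D \<Longrightarrow> h m \<le> h x"
      using continuous_attains_inf[OF D(1) False continuous_on_subset[OF assms(2) D(2)]] by blast
    obtain n where n: "n \<in> D" "\<And>x. x \<in> D \<Longrightarrow> e n \<le> e x"
      using continuous_attains_inf[OF D(1) False continuous_on_subset[OF assms(3) D(2)]] by blast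
    have mpos: "h m > 0" using m(1) h[of m] pos[of m] unfolding D_def by force
    have nneg: "e n \<le> 0" using n(1) by (simp add: D_def)
    define \<epsilon> where "\<epsilon> = h m / (1 - e n)"
    show ?thesis
    proof (rule that[of \<epsilon>])
      show "\<epsilon> > 0" using mpos nneg by (simp add: \<epsilon>_def)
    next
      fix \<delta> x assume *: "0 \<le> \<delta>" "\<delta> \<le> \<epsilon>" "x \<in> C"
      show "h x + \<delta> * e x \<ge> 0"
      proof (cases "x \<in> D")
        case True
        have "\<delta> * - e x \<le> \<epsilon> * (1 - e n)"
          using * n(2)[OF True] True by (intro mult_mono) (auto simp: D_def)
        also have "\<dots> = h m" using nneg by (simp add: \<epsilon>_def)
        finally show ?thesis using m(2)[OF True] by simp
      next
        case False
        then have "e x > 0" using * by (auto simp: D_def)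
        then show ?thesis using h[of x] * by simp
      qed
    qed
  qed
qed

text \<open>The dual cone of an open half-plane is the ray along its inner normal.\<close>

lemma nonneg_on_halfplane_imp_ray:
  fixes a b :: complex
  assumes "a \<noteq> 0" and nonneg: "\<And>v. inner v a > 0 \<Longrightarrow> inner v b \<ge> 0"
  obtains s :: real where "s \<ge> 0" "b = s * a"
proof -
  have aa: "inner a a > 0" using assms(1) by simp
  \<comment> \<open>The test vector \<open>a + r * (\<i> * a)\<close> has the same inner product
    with \<open>a\<close> for every \<open>r\<close>, and an affine function of \<open>r\<close>
    that stays nonnegative has slope 0.\<close>
  have *: "r * inner (\<i> * a) b + inner a b \<ge> 0" for r :: real
  proof -
    have "inner (of_real r * (\<i> * a) + a) a = inner a a"
      by (simp add: inner_complex_def algebra_simps)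
    then have "inner (of_real r * (\<i> * a) + a) b \<ge> 0" using nonneg aa by simp
    then show ?thesis by (simp add: inner_add_left inner_complex_def algebra_simps)
  qed
  have ab: "inner a b \<ge> 0" using *[of 0] by simp
  have orth: "inner (\<i> * a) b = 0"
  proof (rule ccontr)
    assume n: "inner (\<i> * a) b \<noteq> 0"
    show False using *[of "(- inner a b - 1) / inner (\<i> * a) b"] n by simp
  qed
  have "b * cnj a = inner a b"
    using orth by (simp add: complex_eq_iff inner_complex_def algebra_simps)
  then have "b * (cnj a * a) = inner a b * a" by (simp add: mult.assoc[symmetric])
  moreover have "cnj a * a = of_real (inner a a)"
    by (simp add: complex_eq_iff inner_complex_def power2_eq_square)
  ultimately have "b * of_real (inner a a) = of_real (inner a b) * a" by simp
  moreover have "of_real (inner a a) \<noteq> (0::complex)" using aa by simp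
  ultimately have "b = of_real (inner a b / inner a a) * a"
    unfolding of_real_divide times_divide_eq_left by (metis nonzero_eq_divide_eq)
  then show ?thesis using that[of "inner a b / inner a a"] ab aa by simp
qed

text \<open>The sum is the coefficient of degree \<open>card A - 1\<close> in the Lagrange
  interpolant of \<open>q\<close> at the nodes \<open>A\<close>. By the degree bound the interpolant
  is \<open>q\<close> itself, so this coefficient is 0.\<close>

lemma sum_poly_over_node_products_eq_0:
  fixes A :: "'a::field set"
  assumes A: "finite A" and deg: "degree q + 1 < card A"
  shows "(\<Sum>x\<in>A. poly q x / (\<Prod>y\<in>A - {x}. x - y)) = 0"
proof -
  define B where "B x = (\<Prod>y\<in>A - {x}. [:- y, 1:])" for x
  define c where "c x = poly q x / (\<Prod>y\<in>A - {x}. x - y)" for x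
  define L where "L = (\<Sum>x\<in>A. Polynomial.smult (c x) (B x))"
  have degB: "degree (B x) = card A - 1" and leadB: "coeff (B x) (card A - 1) = 1" if "x \<in> A" for x
  proof -
    have "degree (B x) = (\<Sum>y\<in>A - {x}. degree [:- y, 1:])"
      unfolding B_def by (intro degree_prod_eq_sum_degree) auto
    then show d: "degree (B x) = card A - 1" using that A by simp
    have "lead_coeff (B x) = 1" unfolding B_def by (simp add: lead_coeff_prod)
    then show "coeff (B x) (card A - 1) = 1" using d by simp
  qed
  have "degree L \<le> card A - 1" unfolding L_def
    by (intro degree_sum_le[OF A]) (metis degB degree_smult_le)
  then have degL: "degree (L - q) \<le> card A - 1" using deg by (intro degree_diff_le) auto
  have root: "poly (L - q) x = 0" if x: "x \<in> A" for x
  proof -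
    have "poly L x = (\<Sum>u\<in>A. c u * (\<Prod>y\<in>A - {u}. x - y))"
      by (simp add: L_def B_def poly_sum poly_prod)
    also have "\<dots> = (\<Sum>u\<in>{x}. c u * (\<Prod>y\<in>A - {u}. x - y))"
    proof (rule sum.mono_neutral_right)
      show "\<forall>u\<in>A - {x}. c u * (\<Prod>y\<in>A - {u}. x - y) = 0"
        using A x by (auto intro!: prod_zero)
    qed (use A x in auto)
    also have "\<dots> = poly q x" using A by (simp add: c_def)
    finally show ?thesis by simp
  qed
  have "L - q = 0"
  proof (rule ccontr)
    assume n: "L - q \<noteq> 0"
    have "card A \<le> card {x. poly (L - q) x = 0}"
      using root by (intro card_mono poly_roots_finite[OF n]) auto
    also have "\<dots> \<le> degree (L - q)" by (rule poly_roots_degree[OF n])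
    finally show False using degL deg by simp
  qed
  then have "0 = coeff L (card A - 1)" using deg by (simp add: coeff_eq_0)
  also have "\<dots> = (\<Sum>x\<in>A. c x)"
    unfolding L_def coeff_sum by (intro sum.cong) (use leadB in simp_all)
  finally show ?thesis by (simp add: c_def)
qed

text \<open>Fejer-Riesz factorization in degree one. For real \<open>\<beta> = r\<close>, comparing
  coefficients gives \<open>\<alpha> = cnj d / (2 * r)\<close> and a quadratic equation for
  \<open>r^2\<close>; its larger root is taken, since it is positive even for
  \<open>d = 0\<close>.\<close>

lemma norm_affine_eq_nonneg_trig_poly:
  fixes d :: complex and c :: real
  assumes c: "c > 0" and d: "cmod d \<le> c"
  obtains \<alpha> \<beta> where "\<And>x. cmod x = 1 \<Longrightarrow> (cmod (\<alpha> * x + \<beta>))\<^sup>2 = c + inner d x"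
proof -
  define m where "m = sqrt (c\<^sup>2 - (cmod d)\<^sup>2)"
  have "(cmod d)\<^sup>2 \<le> c\<^sup>2" using d by (simp add: power_mono)
  then have m: "m\<^sup>2 = c\<^sup>2 - (cmod d)\<^sup>2" "m \<ge> 0" by (auto simp: m_def)
  define r where "r = sqrt ((c + m) / 2)"
  have r: "r\<^sup>2 = (c + m) / 2" "r > 0" using c m by (auto simp: r_def)
  define a where "a = cnj d / of_real (2 * r)"
  have "(cmod a)\<^sup>2 = (cmod d)\<^sup>2 / (4 * r\<^sup>2)"
    using r by (simp add: a_def norm_divide norm_mult power_divide power_mult_distrib)
  also have "\<dots> = (c - m) / 2"
    using m c r by (simp add: field_simps power2_eq_square)
  finally have ar: "(cmod a)\<^sup>2 + r\<^sup>2 = c" using r by (simp add: field_simps)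
  show ?thesis
  proof (rule that[of a "of_real r"])
    fix x :: complex assume x: "cmod x = 1"
    have "(cmod (a * x + of_real r))\<^sup>2 = (cmod (a * x))\<^sup>2 + r\<^sup>2 + 2 * (r * Re (a * x))"
      by (simp only: cmod_power2) (simp add: power2_eq_square algebra_simps)
    also have "r * Re (a * x) = Re (cnj d * x) / 2" using r
      by (simp add: a_def field_simps Re_divide_of_real Im_divide_of_real)
    finally show "(cmod (a * x + of_real r))\<^sup>2 = c + inner d x"
      using x ar by (simp add: norm_mult inner_complex_def)
  qed
qed

section \<open>Stationary weights on the unit circle\<close>

text \<open>Points of the circle are extreme in the disc: \<open>1 - inner z x\<close> is
  nonnegative on \<open>S\<close> with weighted mean 0, so it vanishes at any \<open>x\<close> of
  positive weight, which forces \<open>x = z\<close>.\<close>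

lemma unit_in_convex_hull:
  fixes S :: "complex set"
  assumes S: "finite S" "\<And>x. x \<in> S \<Longrightarrow> cmod x = 1"
    and z: "z \<in> convex hull S" "cmod z = 1"
  shows "z \<in> S"
proof -
  obtain u where u: "\<And>x. x \<in> S \<Longrightarrow> 0 \<le> u x" "sum u S = 1" "(\<Sum>x\<in>S. u x *\<^sub>R x) = z"
    using z(1) unfolding convex_hull_finite[OF S(1)] by auto
  have zz: "inner z z = 1" using z(2) by (simp add: dot_square_norm)
  have le: "inner z x \<le> 1" if "x \<in> S" for x
    using norm_cauchy_schwarz[of z x] z(2) S(2)[OF that] by simp
  have "(\<Sum>x\<in>S. u x * inner z x) = inner z (\<Sum>x\<in>S. u x *\<^sub>R x)"
    by (simp add: inner_sum_right)
  then have "(\<Sum>x\<in>S. u x * (1 - inner z x)) = 0"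
    using u zz by (simp add: right_diff_distrib sum_subtractf)
  then have 0: "u x * (1 - inner z x) = 0" if "x \<in> S" for x
    using sum_nonneg_eq_0_iff[OF S(1), of "\<lambda>x. u x * (1 - inner z x)"] u(1) le that by simp
  obtain x where x: "x \<in> S" "u x \<noteq> 0" using u(2) by (metis sum.neutral zero_neq_one)
  then have "inner z x = 1" using 0[of x] by simp
  then have "inner (x - z) (x - z) = 0"
    using zz S(2)[OF x(1)]
    by (simp add: inner_diff_left inner_diff_right inner_commute[of x z]) (simp add: dot_square_norm)
  then show ?thesis using x by simp
qed

text \<open>If \<open>z\<close> had norm 1, extremality would put it in every
  \<open>A - {x}\<close>, even in \<open>A - {z}\<close>. The strict bound makes the feasible set of
  the minimisation bounded.\<close>

lemma norm_less_1_if_in_convex_hulls: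
  fixes A :: "complex set"
  assumes A: "finite A" "A \<noteq> {}" "\<And>x. x \<in> A \<Longrightarrow> cmod x = 1"
    and z: "\<And>x. x \<in> A \<Longrightarrow> z \<in> convex hull (A - {x})"
  shows "cmod z < 1"
proof (rule ccontr)
  assume n: "\<not> cmod z < 1"
  obtain a where a: "a \<in> A" using A(2) by blast
  have "convex hull (A - {a}) \<subseteq> cball 0 1"
    by (intro hull_minimal convex_cball) (use A(3) in auto)
  then have 1: "cmod z = 1" using z[OF a] n by auto
  have "z \<in> A - {x}" if "x \<in> A" for x
    by (rule unit_in_convex_hull[OF _ _ z[OF that] 1]) (use A(1,3) in auto)
  then show False using a by blast
qed

text \<open>Affine functions with value 1 at \<open>z\<close> are written
  \<open>1 + inner d (x - z)\<close>, so \<open>d\<close> is the variable of the minimisation. The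
  second conclusion is the first-order condition, tested on directions that point strictly inward at
  every zero on the circle, since small steps along these stay feasible.\<close>

lemma exists_stationary_weight:
  fixes A :: "complex set" and w :: "complex \<Rightarrow> real"
  assumes A: "finite A" "\<And>x. x \<in> A \<Longrightarrow> cmod x = 1" and w: "\<And>x. x \<in> A \<Longrightarrow> w x > 0"
    and z: "cmod z < 1"
  obtains d where "\<And>x. cmod x = 1 \<Longrightarrow> 1 + inner d (x - z) \<ge> 0"
    and "\<And>v. (\<And>x. cmod x = 1 \<Longrightarrow> 1 + inner d (x - z) = 0 \<Longrightarrow> inner v (x - z) > 0) \<Longrightarrow>
      inner v (\<Sum>x\<in>A. (w x * sqrt (1 + inner d (x - z))) *\<^sub>R (x - z)) \<ge> 0"
proof -
  define h where "h d x = 1 + inner d (x - z)" for d x :: complex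
  define K where "K = {d. \<forall>x\<in>sphere 0 1. h d x \<ge> 0}"
  define F where "F d = (\<Sum>x\<in>A. w x * (h d x * sqrt (h d x)))" for d
  have "K = (\<Inter>x\<in>sphere 0 1. {d. h d x \<ge> 0})" by (auto simp: K_def)
  moreover have "closed {d. h d x \<ge> 0}" for x
    unfolding h_def by (intro closed_Collect_le continuous_intros)
  ultimately have "closed K" by (auto intro: closed_INT)
  moreover have "bounded K"
  proof (rule boundedI)
    fix d assume d: "d \<in> K"
    show "cmod d \<le> 1 / (1 - cmod z)"
    proof (cases "d = 0")
      case False
      \<comment> \<open>The constraint is sharpest where \<open>inner d\<close> is least on the
        circle.\<close>
      define x where "x = (- 1 / cmod d) *\<^sub>R d"
      have "cmod x = 1" using False by (simp add: x_def)
      then have "h d x \<ge> 0" using d by (simp add: K_def)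
      moreover have "inner d x = - cmod d"
        using False by (simp add: x_def dot_square_norm power2_eq_square)
      moreover have "- inner d z \<le> cmod d * cmod z"
        using norm_cauchy_schwarz[of d "-z"] by simp
      ultimately have "cmod d * (1 - cmod z) \<le> 1" by (simp add: h_def inner_diff_right algebra_simps)
      then show ?thesis using z by (simp add: pos_le_divide_eq)
    qed (use z in simp)
  qed
  ultimately have K: "compact K" by (simp add: compact_eq_bounded_closed)
  have "0 \<in> K" by (simp add: K_def h_def)
  have "continuous_on K F" unfolding F_def h_def by (intro continuous_intros)
  then obtain d where d: "d \<in> K" "\<And>d'. d' \<in> K \<Longrightarrow> F d \<le> F d'"
    using continuous_attains_inf[OF K] \<open>0 \<in> K\<close> by blast
  show ?thesis
  proof (rule that[of d])
    show "1 + inner d (x - z) \<ge> 0" if "cmod x = 1" for x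
      using d(1) that by (simp add: K_def h_def)
  next
    fix v assume v: "\<And>x. cmod x = 1 \<Longrightarrow> 1 + inner d (x - z) = 0 \<Longrightarrow> inner v (x - z) > 0"
    obtain \<epsilon> where \<epsilon>: "\<epsilon> > 0" "\<And>\<delta> x. 0 \<le> \<delta> \<Longrightarrow> \<delta> \<le> \<epsilon> \<Longrightarrow> x \<in> sphere 0 1 \<Longrightarrow>
        h d x + \<delta> * inner v (x - z) \<ge> 0"
    proof (rule compact_perturb_nonneg[of "sphere 0 1" "h d" "\<lambda>x. inner v (x - z)"])
      show "continuous_on (sphere 0 1) (h d)" unfolding h_def by (intro continuous_intros)
      show "continuous_on (sphere 0 1) (\<lambda>x. inner v (x - z))" by (intro continuous_intros)
    qed (use d(1) v in \<open>auto simp: K_def h_def\<close>)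
    define D where "D \<delta> = (\<Sum>x\<in>A. w x * sqrt (h (d + \<delta> *\<^sub>R v) x) * inner v (x - z))" for \<delta> :: real
    \<comment> \<open>The square roots need not be differentiable at \<open>\<delta> = 0\<close>, so the first-order condition comes from
      the convexity inequality at \<open>d + \<delta> v\<close> and continuity as \<open>\<delta> \<rightarrow> 0\<close>.\<close>
    have "D \<delta> \<ge> 0" if \<delta>: "0 < \<delta>" "\<delta> < \<epsilon>" for \<delta>
    proof -
      have eq: "h (d + \<delta> *\<^sub>R v) x = h d x + \<delta> * inner v (x - z)" for x
        by (simp add: h_def inner_add_left)
      have in_K: "d + \<delta> *\<^sub>R v \<in> K"
        using \<epsilon>(2)[of \<delta>] \<delta> by (auto simp: K_def eq)
      have "0 \<le> F (d + \<delta> *\<^sub>R v) - F d" using d(2)[OF in_K] by simp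
      also have "\<dots> = (\<Sum>x\<in>A. w x * (h (d + \<delta> *\<^sub>R v) x * sqrt (h (d + \<delta> *\<^sub>R v) x) - h d x * sqrt (h d x)))"
        by (simp add: F_def sum_subtractf right_diff_distrib)
      also have "\<dots> \<le> (\<Sum>x\<in>A. w x * (3 / 2 * sqrt (h (d + \<delta> *\<^sub>R v) x) * (h (d + \<delta> *\<^sub>R v) x - h d x)))"
      proof (intro sum_mono mult_left_mono)
        fix x assume "x \<in> A"
        then show "h (d + \<delta> *\<^sub>R v) x * sqrt (h (d + \<delta> *\<^sub>R v) x) - h d x * sqrt (h d x)
            \<le> 3 / 2 * sqrt (h (d + \<delta> *\<^sub>R v) x) * (h (d + \<delta> *\<^sub>R v) x - h d x)"
          using A(2) in_K d(1) by (intro diff_three_halves_le) (auto simp: K_def)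
      qed (use w in \<open>simp add: less_imp_le\<close>)
      also have "\<dots> = 3 / 2 * \<delta> * D \<delta>"
        unfolding D_def sum_distrib_left by (intro sum.cong refl) (simp add: eq)
      finally show ?thesis using \<delta> by (simp add: zero_le_mult_iff)
    qed
    then have "eventually (\<lambda>\<delta>. 0 \<le> D \<delta>) (at_right 0)"
      using \<epsilon>(1) unfolding eventually_at_right_field by blast
    moreover have "isCont D 0" unfolding D_def h_def by (intro continuous_intros)
    then have "(D \<longlongrightarrow> D 0) (at_right 0)"
      by (metis isCont_def filterlim_at_split)
    ultimately have "0 \<le> D 0" by (intro tendsto_lowerbound) auto
    also have "D 0 = inner v (\<Sum>x\<in>A. (w x * sqrt (1 + inner d (x - z))) *\<^sub>R (x - z))"
      by (simp add: D_def h_def inner_sum_right mult.assoc)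
    finally show "0 \<le> inner v (\<Sum>x\<in>A. (w x * sqrt (1 + inner d (x - z))) *\<^sub>R (x - z))" .
  qed
qed

section \<open>The boundary case\<close>

text \<open>With half-angles as parameters, chord lengths are sines of differences.\<close>

lemma norm_cis_diff: "cmod (cis (2 * a) - cis (2 * b)) = 2 * \<bar>sin (a - b)\<bar>"
proof -
  have "(cmod (cis (2 * a) - cis (2 * b)))\<^sup>2 = (2 * \<bar>sin (a - b)\<bar>)\<^sup>2"
  proof -
    have "(cmod (cis (2 * a) - cis (2 * b)))\<^sup>2 =
        (cos (2 * a) - cos (2 * b))\<^sup>2 + (sin (2 * a) - sin (2 * b))\<^sup>2"
      by (simp add: cmod_power2)
    also have "\<dots> = 2 - 2 * cos (2 * (a - b))"
      using sin_cos_squared_add[of "2 * a"] sin_cos_squared_add[of "2 * b"]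
      by (simp add: right_diff_distrib cos_diff power2_eq_square algebra_simps)
    also have "\<dots> = (2 * \<bar>sin (a - b)\<bar>)\<^sup>2"
      unfolding cos_double_sin by (simp add: power2_eq_square)
    finally show ?thesis .
  qed
  then show ?thesis by (simp only: power2_eq_iff_nonneg[OF norm_ge_zero] abs_ge_zero mult_nonneg_nonneg)
qed

text \<open>A signed form of Ptolemy's theorem for the points of the circle with half-angles 0,
  \<open>a\<close>, \<open>b\<close>, \<open>c\<close>.\<close>

lemma sin_diff_cyclic:
  fixes a b c :: real
  shows "sin a * sin (c - b) - sin b * sin (c - a) + sin c * sin (b - a) = 0"
  by (simp add: sin_diff algebra_simps)

text \<open>Order \<open>A\<close> along the circle starting from \<open>p\<close>. The affine function vanishes at the second and
  fourth points, and \<open>y\<close> is the third.\<close>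

lemma exists_separating_affine:
  fixes A :: "complex set"
  assumes A: "card A = 5" "\<And>x. x \<in> A \<Longrightarrow> cmod x = 1" and p: "cmod p = 1"
  obtains y q c where "y \<in> A" "\<And>x. x \<in> A - {y} \<Longrightarrow> c + inner q x \<ge> 0" "c + inner q p > 0"
    "(\<Sum>x\<in>A. cmod (x - p) / (\<Prod>u\<in>A - {x}. cmod (x - u)) * (c + inner q x)) = 0"
proof -
  \<comment> \<open>Here \<open>a\<close> is half the angle measured from \<open>p\<close>, so
    \<open>0 \<le> a < pi\<close> covers the circle once.\<close>
  define f where "f a = p * cis (2 * a)" for a
  define T where "T = {a. 0 \<le> a \<and> a < pi \<and> f a \<in> A}"
  have fd: "cmod (f a - f b) = 2 * \<bar>sin (a - b)\<bar>" for a b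
    using p norm_cis_diff[of a b] by (simp add: f_def right_diff_distrib[symmetric] norm_mult del: cis_mult)
  have inj: "inj_on f T"
  proof (rule inj_onI)
    fix a b assume ab: "a \<in> T" "b \<in> T" "f a = f b"
    then have "sin (a - b) = 0" using fd[of a b] by simp
    then show "a = b"
      using ab sin_gt_zero[of "a - b"] sin_gt_zero[of "b - a"] sin_minus[of "a - b"]
      by (cases a b rule: linorder_cases) (auto simp: T_def)
  qed
  have "x \<in> f ` T" if x: "x \<in> A" for x
  proof -
    have "cmod (x / p) = 1" using A(2)[OF x] p by (simp add: norm_divide)
    then obtain t where t: "0 \<le> t" "t < 2 * pi" "x / p = cis t"
      using sincos_total_2pi[of "Re (x / p)" "Im (x / p)"] cmod_power2[of "x / p"]
      by (auto simp: complex_eq_iff)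
    moreover have "p \<noteq> 0" using p by auto
    ultimately have "x = f (t / 2)" by (simp add: f_def nonzero_divide_eq_eq mult.commute)
    then show ?thesis using t x by (intro image_eqI[of _ _ "t / 2"]) (auto simp: T_def)
  qed
  then have AT: "A = f ` T" by (auto simp: T_def)
  have cT: "card T = 5" using A(1) inj by (simp add: AT card_image)
  define ts where "ts = sorted_list_of_set T"
  have ts: "length ts = 5" "sorted_wrt (<) ts" "set ts = T"
    using cT by (auto simp: ts_def card_ge_0_finite)
  obtain a1 a2 a3 a4 a5 where tseq: "ts = [a1, a2, a3, a4, a5]"
    using ts(1) by (auto simp: numeral_eq_Suc length_Suc_conv)
  have ord: "0 \<le> a1" "a1 < a2" "a2 < a3" "a3 < a4" "a4 < a5" "a5 < pi"
    using ts(2,3) by (auto simp: tseq T_def)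
  have AE: "A = {f a1, f a2, f a3, f a4, f a5}" using ts(3) by (auto simp: AT tseq)
  have dist: "distinct [f a1, f a2, f a3, f a4, f a5]"
  proof -
    have "distinct (map f ts)" using inj ts by (simp add: distinct_map strict_sorted_iff)
    then show ?thesis by (simp add: tseq)
  qed
  \<comment> \<open>The line through \<open>f a2\<close> and \<open>f a4\<close> has unit normal
    \<open>p * cis (a2 + a4)\<close> and signed distance \<open>cos (a4 - a2)\<close> from the
    origin. The signs make the function positive at \<open>p\<close>.\<close>
  define c where "c = cos (a4 - a2)"
  define q where "q = - p * cis (a2 + a4)"
  have g: "c + inner q (f a) = 2 * sin (a - a2) * sin (a - a4)" for a
  proof -
    have pp: "Re p * Re p + Im p * Im p = 1" using p cmod_power2[of p] by (simp add: power2_eq_square)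
    have "inner q (f a) = - ((Re p * Re p + Im p * Im p) * cos (2 * a - (a2 + a4)))"
      by (simp add: q_def f_def inner_complex_def cos_diff algebra_simps)
    then have "c + inner q (f a) = cos (a4 - a2) - cos (2 * a - (a2 + a4))"
      unfolding pp c_def by simp
    also have "\<dots> = 2 * sin (a - a2) * sin (a - a4)"
    proof -
      have "(a4 - a2 + (2 * a - (a2 + a4))) / 2 = a - a2" "(2 * a - (a2 + a4) - (a4 - a2)) / 2 = a - a4"
        by (simp_all add: field_simps)
      then show ?thesis unfolding cos_diff_cos[of "a4 - a2"] by (simp only:)
    qed
    finally show ?thesis .
  qed
  have sinp: "sin (b - a) > 0" "sin (a - b) < 0" if "0 \<le> a" "a < b" "b < pi" for a b
    using sin_gt_zero[of "b - a"] sin_minus[of "b - a"] that by auto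
  have f0: "f 0 = p" by (simp add: f_def)
  have fp: "cmod (f a - p) = 2 * sin a" if "0 \<le> a" "a < pi" for a
    using fd[of a 0] sin_ge_zero[of a] that by (simp add: f0)
  show ?thesis
  \<comment> \<open>\<open>f a3\<close> is the only point of \<open>A\<close> strictly beyond that
    line as seen from \<open>p\<close>.\<close>
  proof (rule that[of "f a3" c q])
    show "f a3 \<in> A" by (simp add: AE)
    show "c + inner q x \<ge> 0" if x: "x \<in> A - {f a3}" for x
    proof -
      from x consider "x = f a1" | "x = f a2" | "x = f a4" | "x = f a5" by (auto simp: AE)
      then show ?thesis
        using sinp[of a1 a2] sinp[of a1 a4] sinp[of a2 a5] sinp[of a4 a5] ord
        by cases (auto simp: g mult_nonpos_nonpos)
    qed
    show "c + inner q p > 0"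
      using sinp[of 0 a2] sinp[of 0 a4] ord g[of 0] unfolding f0 by (simp add: mult_neg_neg)
    define s21 where "s21 = sin (a2 - a1)"
    define s31 where "s31 = sin (a3 - a1)"
    define s41 where "s41 = sin (a4 - a1)"
    define s51 where "s51 = sin (a5 - a1)"
    define s32 where "s32 = sin (a3 - a2)"
    define s52 where "s52 = sin (a5 - a2)"
    define s43 where "s43 = sin (a4 - a3)"
    define s53 where "s53 = sin (a5 - a3)"
    define s54 where "s54 = sin (a5 - a4)"
    note sdefs = s21_def s31_def s41_def s51_def s32_def s52_def s43_def s53_def s54_def
    have pos: "s21 > 0" "s31 > 0" "s41 > 0" "s51 > 0" "s32 > 0" "s52 > 0" "s43 > 0" "s53 > 0" "s54 > 0"
      using sinp ord by (auto simp: sdefs)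
    have neg: "sin (a1 - a2) = - s21" "sin (a1 - a3) = - s31" "sin (a1 - a4) = - s41"
      "sin (a1 - a5) = - s51" "sin (a3 - a4) = - s43" "sin (a3 - a5) = - s53"
      unfolding sdefs sin_minus[symmetric] by simp_all
    define W where "W x = cmod (x - p) / (\<Prod>u\<in>A - {x}. cmod (x - u)) * (c + inner q x)" for x
    \<comment> \<open>The two sines from the affine function cancel the distances to
      \<open>f a2\<close> and \<open>f a4\<close>. The same happens at \<open>f a3\<close> and
      \<open>f a5\<close>, so besides the distance to \<open>p\<close> only distances among these
      three points remain.\<close>
    have W1: "W (f a1) = sin a1 / (s31 * s51) / 4"
    proof -
      have "A - {f a1} = {f a2, f a3, f a4, f a5}" using dist by (auto simp: AE)
      then have "W (f a1) = 2 * sin a1 / (2 * s21 * (2 * s31 * (2 * s41 * (2 * s51)))) * (2 * s21 * s41)"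
        using dist pos ord by (simp add: W_def fp fd g neg)
      then show ?thesis using pos by simp
    qed
    have W3: "W (f a3) = - sin a3 / (s31 * s53) / 4"
    proof -
      have "A - {f a3} = {f a1, f a2, f a4, f a5}" using dist by (auto simp: AE)
      then have "W (f a3) = 2 * sin a3 / (2 * s31 * (2 * s32 * (2 * s43 * (2 * s53)))) * (2 * s32 * - s43)"
        using dist pos ord by (simp add: W_def fp fd g neg s31_def[symmetric] s32_def[symmetric])
      then show ?thesis using pos by simp
    qed
    have W5: "W (f a5) = sin a5 / (s51 * s53) / 4"
    proof -
      have "A - {f a5} = {f a1, f a2, f a3, f a4}" using dist by (auto simp: AE)
      then have "W (f a5) = 2 * sin a5 / (2 * s51 * (2 * s52 * (2 * s53 * (2 * s54)))) * (2 * s52 * s54)"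
        using dist pos ord
        by (simp add: W_def fp fd g s51_def[symmetric] s52_def[symmetric] s53_def[symmetric] s54_def[symmetric])
      then show ?thesis using pos by simp
    qed
    have W24: "W (f a2) = 0" "W (f a4) = 0" by (simp_all add: W_def g)
    have "(\<Sum>x\<in>A. W x) = W (f a1) + W (f a3) + W (f a5)"
      using dist by (simp add: AE W24)
    also have "\<dots> = (sin a1 * s53 - sin a3 * s51 + sin a5 * s31) / (4 * s31 * s51 * s53)"
      unfolding W1 W3 W5 using pos by (simp add: field_simps)
    \<comment> \<open>The numerator is Ptolemy's relation for \<open>p\<close>, \<open>f a1\<close>,
      \<open>f a3\<close>, \<open>f a5\<close>.\<close>
    also have "\<dots> = 0" using sin_diff_cyclic[of a1 a5 a3] by (simp add: sdefs)
    finally show "(\<Sum>x\<in>A. cmod (x - p) / (\<Prod>u\<in>A - {x}. cmod (x - u)) * (c + inner q x)) = 0"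
      by (simp add: W_def)
  qed
qed

section \<open>The inclusion of \<open>\<Omega>\<^sub>2\<close> in \<open>\<Sigma>\<^sub>2\<close>\<close>

text \<open>The weights are left unnormalised, so the positive total is a separate claim: the
  minimising \<open>h\<close> cannot vanish on all of \<open>A\<close>, as \<open>h z = 1\<close>
  and \<open>z\<close> lies in the hull.\<close>

lemma exists_balanced_weights:
  fixes A :: "complex set"
  assumes A: "card A = 5" "\<And>x. x \<in> A \<Longrightarrow> cmod x = 1"
    and z: "\<And>x. x \<in> A \<Longrightarrow> z \<in> convex hull (A - {x})"
  obtains \<alpha> \<beta> where "(\<Sum>x\<in>A. cmod (\<alpha> * x + \<beta>) / (\<Prod>y\<in>A - {x}. cmod (x - y))) > 0"
    "(\<Sum>x\<in>A. (cmod (\<alpha> * x + \<beta>) / (\<Prod>y\<in>A - {x}. cmod (x - y))) *\<^sub>R (x - z)) = 0"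
proof -
  have fin: "finite A" and ne: "A \<noteq> {}" using A(1) by (auto simp: card_ge_0_finite)
  have z1: "cmod z < 1" using fin ne A(2) z by (rule norm_less_1_if_in_convex_hulls)
  define w where "w x = 1 / (\<Prod>y\<in>A - {x}. cmod (x - y))" for x
  have w: "w x > 0" for x using fin by (auto simp: w_def intro!: prod_pos)
  obtain d where d: "\<And>x. cmod x = 1 \<Longrightarrow> 1 + inner d (x - z) \<ge> 0"
    "\<And>v. (\<And>x. cmod x = 1 \<Longrightarrow> 1 + inner d (x - z) = 0 \<Longrightarrow> inner v (x - z) > 0) \<Longrightarrow>
      inner v (\<Sum>x\<in>A. (w x * sqrt (1 + inner d (x - z))) *\<^sub>R (x - z)) \<ge> 0"
    by (rule exists_stationary_weight[where w = w, OF fin A(2) w z1]) blast+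
  define h where "h x = 1 + inner d (x - z)" for x
  define k where "k x = w x * sqrt (h x)" for x
  define G where "G = (\<Sum>x\<in>A. k x *\<^sub>R (x - z))"
  have h_ge: "h x \<ge> 0" if "cmod x = 1" for x using d(1) that by (simp add: h_def)
  have k_ge: "k x \<ge> 0" if "x \<in> A" for x using w[of x] h_ge A(2) that by (simp add: k_def)
  have stat: "inner v G \<ge> 0" if "\<And>x. cmod x = 1 \<Longrightarrow> h x = 0 \<Longrightarrow> inner v (x - z) > 0" for v
    using d(2)[of v] that unfolding G_def k_def h_def by blast
  define c where "c = 1 - inner d z"
  have h_c: "h x = c + inner d x" for x by (simp add: h_def c_def inner_diff_right)
  \<comment> \<open>Nonnegativity at the point of the circle opposite to \<open>d\<close>; the
    degree-one factorization needs this bound.\<close>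
  have dc: "cmod d \<le> c"
  proof (cases "d = 0")
    case False
    have "inner d ((- 1 / cmod d) *\<^sub>R d) = - cmod d"
      using False by (simp add: dot_square_norm power2_eq_square)
    then show ?thesis
      using h_ge[of "(- 1 / cmod d) *\<^sub>R d"] False by (simp add: h_c)
  qed (simp add: c_def)
  have c: "c > 0"
  proof (rule ccontr)
    assume "\<not> c > 0"
    then have "cmod d = 0" using dc norm_ge_zero[of d] by linarith
    then show False using \<open>\<not> c > 0\<close> by (simp add: c_def)
  qed
  have G0: "G = 0"
  proof (cases "\<exists>p. cmod p = 1 \<and> h p = 0")
    case False
    \<comment> \<open>Without a zero on the circle every direction is admissible, in particular
      \<open>- G\<close>.\<close>
    then show ?thesis using stat[of "- G"] inner_gt_zero_iff[of G] by fastforce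
  next
    case True
    then obtain p where p: "cmod p = 1" "h p = 0" by blast
    have dpc: "inner d p = - c" using p(2) by (simp add: h_c)
    \<comment> \<open>Equality case of Cauchy-Schwarz: \<open>inner d p = - c\<close> and
      \<open>cmod d \<le> c\<close> force \<open>d\<close> to point opposite to
      \<open>p\<close>.\<close>
    have "inner (d + cmod d *\<^sub>R p) (d + cmod d *\<^sub>R p) = 2 * (cmod d * cmod d) + 2 * cmod d * inner d p"
      using p by (simp add: inner_add_left inner_add_right inner_commute[of p d])
        (simp add: dot_square_norm power2_eq_square algebra_simps)
    also have "\<dots> = 2 * cmod d * (cmod d - c)"
      unfolding dpc by (simp add: algebra_simps)
    also have "\<dots> \<le> 0" using dc by (intro mult_nonneg_nonpos) auto
    finally have "d + cmod d *\<^sub>R p = 0"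
      using inner_gt_zero_iff[of "d + cmod d *\<^sub>R p"] by linarith
    then have dp: "d = - (cmod d *\<^sub>R p)" by (simp only: eq_neg_iff_add_eq_0)
    have "inner d p = - cmod d" by (subst dp) (simp add: p(1) dot_square_norm)
    then have cd: "c = cmod d" using p(2) by (simp add: h_c)
    have h_p: "h x = c / 2 * (cmod (x - p))\<^sup>2" if "cmod x = 1" for x
    proof -
      have 1: "(cmod (x - p))\<^sup>2 = 2 - 2 * inner p x"
        using that p by (simp add: dot_square_norm[symmetric] inner_diff inner_commute)
          (simp add: dot_square_norm)
      have 2: "inner d x = - c * inner p x" by (subst dp) (simp add: cd)
      show ?thesis unfolding h_c 1 2 by (simp add: algebra_simps)
    qed
    have "p - z \<noteq> 0" using p(1) z1 by auto
    \<comment> \<open>\<open>p\<close> is the only zero of \<open>h\<close> on the circle, so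
      admissible directions fill a half-plane and \<open>G\<close> lies on the ray of
      \<open>p - z\<close>.\<close>
    moreover have "inner v G \<ge> 0" if "inner v (p - z) > 0" for v
    proof (rule stat)
      fix x :: complex assume "cmod x = 1" "h x = 0"
      then show "inner v (x - z) > 0" using h_p[of x] c that by simp
    qed
    ultimately obtain r :: real where r: "r \<ge> 0" "G = r * (p - z)"
      using nonneg_on_halfplane_imp_ray by blast
    have inner_G: "inner q G = r * inner q (p - z)" for q
      unfolding r(2) scaleR_conv_of_real[symmetric] by simp
    have inner_G': "inner q G = (\<Sum>x\<in>A. k x * inner q (x - z))" for q
      by (simp add: G_def inner_sum_right)
    \<comment> \<open>Pairing \<open>G\<close> with \<open>d\<close> bounds \<open>r\<close> by the
      total weight: the barycentre of the weights \<open>k\<close> lies on the segment from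
      \<open>z\<close> to \<open>p\<close>.\<close>
    have "inner d (p - z) = - 1" using p(2) by (simp add: h_def)
    then have "inner d G = - r" by (simp add: inner_G)
    then have "(\<Sum>x\<in>A. k x) - r = (\<Sum>x\<in>A. k x * h x)"
      unfolding inner_G' by (simp add: h_def distrib_left sum.distrib)
    then have rT: "r \<le> (\<Sum>x\<in>A. k x)"
      using sum_nonneg[of A "\<lambda>x. k x * h x"] k_ge h_ge A(2) by simp
    obtain y q b where g: "y \<in> A" "\<And>x. x \<in> A - {y} \<Longrightarrow> b + inner q x \<ge> 0" "b + inner q p > 0"
      "(\<Sum>x\<in>A. cmod (x - p) / (\<Prod>u\<in>A - {x}. cmod (x - u)) * (b + inner q x)) = 0"
      by (rule exists_separating_affine[OF A p(1)]) blast+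
    have "k x = sqrt (c / 2) * (cmod (x - p) / (\<Prod>u\<in>A - {x}. cmod (x - u)))" if "x \<in> A" for x
      unfolding k_def h_p[OF A(2)[OF that]] real_sqrt_mult w_def by simp
    then have "(\<Sum>x\<in>A. k x * (b + inner q x)) = sqrt (c / 2) *
        (\<Sum>x\<in>A. cmod (x - p) / (\<Prod>u\<in>A - {x}. cmod (x - u)) * (b + inner q x))"
      unfolding sum_distrib_left by (intro sum.cong) (simp_all add: mult.assoc)
    then have gk: "(\<Sum>x\<in>A. k x * (b + inner q x)) = 0" using g(4) by simp
    \<comment> \<open>\<open>z\<close> is in the hull of the points other than \<open>y\<close>,
      where the affine function is nonnegative.\<close>
    have "convex hull (A - {y}) \<subseteq> {x. inner q x \<ge> - b}"
      by (intro hull_minimal convex_halfspace_ge) (use g(2) in force)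
    then have gz: "b + inner q z \<ge> 0" using z[OF g(1)] by auto
    have "inner q G = (\<Sum>x\<in>A. k x * (b + inner q x)) - (\<Sum>x\<in>A. k x) * (b + inner q z)"
      unfolding inner_G' sum_distrib_right sum_subtractf[symmetric]
      by (intro sum.cong) (simp_all add: inner_diff_right algebra_simps)
    \<comment> \<open>The vanishing weighted sum is a combination of the values at \<open>p\<close>
      and \<open>z\<close> with nonnegative coefficients; positivity at \<open>p\<close> forces
      \<open>r = 0\<close>.\<close>
    then have "r * (b + inner q p) + ((\<Sum>x\<in>A. k x) - r) * (b + inner q z) = 0"
      unfolding gk inner_G by (simp add: inner_diff_right algebra_simps)
    moreover have "((\<Sum>x\<in>A. k x) - r) * (b + inner q z) \<ge> 0" using rT gz by simp
    moreover have "r * (b + inner q p) \<ge> 0" using r g(3) by simp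
    ultimately have "r * (b + inner q p) = 0" by linarith
    then show ?thesis using g(3) r by simp
  qed
  have pos: "(\<Sum>x\<in>A. k x) > 0"
  proof (rule ccontr)
    assume "\<not> (\<Sum>x\<in>A. k x) > 0"
    then have "(\<Sum>x\<in>A. k x) = 0" using sum_nonneg[of A k] k_ge by force
    then have "k x = 0" if "x \<in> A" for x
      using that k_ge fin by (simp add: sum_nonneg_eq_0_iff)
    then have h0: "h x = 0" if "x \<in> A" for x
      using that w[of x] by (fastforce simp: k_def)
    have "inner d x = inner d z - 1" if "x \<in> A" for x
      using h0[OF that] by (simp add: h_def inner_diff_right)
    then have "A \<subseteq> {x. inner d x \<le> inner d z - 1}" by auto
    then have "convex hull A \<subseteq> {x. inner d x \<le> inner d z - 1}"
      by (intro hull_minimal convex_halfspace_le)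
    moreover have "z \<in> convex hull A"
      using ne z hull_mono[of "A - {_}" A convex] by blast
    ultimately show False by auto
  qed
  obtain \<alpha> \<beta> where ab: "\<And>x. cmod x = 1 \<Longrightarrow> (cmod (\<alpha> * x + \<beta>))\<^sup>2 = c + inner d x"
    by (rule norm_affine_eq_nonneg_trig_poly[OF c dc]) blast
  have "cmod (\<alpha> * x + \<beta>) / (\<Prod>y\<in>A - {x}. cmod (x - y)) = k x" if "x \<in> A" for x
  proof -
    have "sqrt (h x) = cmod (\<alpha> * x + \<beta>)"
      unfolding h_c ab[OF A(2)[OF that], symmetric] by simp
    then show ?thesis by (simp add: k_def w_def)
  qed
  then show ?thesis using that[of \<alpha> \<beta>] pos G0 by (simp add: G_def cong: sum.cong)
qed

text \<open>The rows of \<open>\<alpha>\<close> are built so that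
  \<open>\<alpha> 0 j * cnj (\<alpha> 1 j)\<close> is \<open>v (es ! j)\<close>. The four
  orthogonality relations then ask that \<open>v x\<close>, \<open>x * v x\<close>,
  \<open>cnj (v x)\<close> and \<open>x * cnj (v x)\<close> sum to 0, which interpolation on five
  nodes provides.\<close>

lemma Omega_list_subset_Sigma_list:
  assumes es: "distinct es" "length es = 5" "\<And>x. x \<in> set es \<Longrightarrow> cmod x = 1"
  shows "Omega_list 2 es \<subseteq> Sigma_list 2 es"
proof
  fix z assume z: "z \<in> Omega_list 2 es"
  define A where "A = set es"
  have A: "finite A" "card A = 5" "\<And>x. x \<in> A \<Longrightarrow> cmod x = 1"
    using es by (auto simp: A_def distinct_card)
  have hull: "z \<in> convex hull (A - {x})" if x: "x \<in> A" for x
  proof -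
    obtain j where j: "j < length es" "x = es ! j" using x by (auto simp: A_def in_set_conv_nth)
    have "(!) es ` ({..<length es} - {j}) = A - {x}"
      using es(1) j by (auto simp: A_def in_set_conv_nth nth_eq_iff_index_eq)
    \<comment> \<open>As \<open>5 - 2 + 1 = 4\<close>, the index sets in \<open>Omega_list\<close>
      are the complements of single indices.\<close>
    moreover have "z \<in> convex hull ((!) es ` ({..<length es} - {j}))"
      using z j(1) es(2) unfolding Omega_list_def by auto
    ultimately show ?thesis by simp
  qed
  obtain a b where ab: "(\<Sum>x\<in>A. cmod (a * x + b) / (\<Prod>y\<in>A - {x}. cmod (x - y))) > 0"
    "(\<Sum>x\<in>A. (cmod (a * x + b) / (\<Prod>y\<in>A - {x}. cmod (x - y))) *\<^sub>R (x - z)) = 0"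
    by (rule exists_balanced_weights[OF A(2,3) hull])
  define s where "s x = cmod (a * x + b) / (\<Prod>y\<in>A - {x}. cmod (x - y))" for x
  define N where "N = (\<Sum>x\<in>A. s x)"
  have N: "N > 0" using ab(1) by (simp add: N_def s_def)
  define t where "t x = s x / N" for x
  \<comment> \<open>The extra factor \<open>x\<close> makes \<open>\<Sum>x\<in>A. x * cnj (v x)\<close> vanish too, since \<open>cnj x = 1 / x\<close>.\<close>
  define v where "v x = (a * x + b) * x / (\<Prod>y\<in>A - {x}. x - y) / of_real N" for x
  have t_ge: "t x \<ge> 0" for x using N by (auto simp: t_def s_def intro!: divide_nonneg_nonneg mult_nonneg_nonneg prod_nonneg)
  have v_norm: "cmod (v x) = t x" if "x \<in> A" for x
    using N A(3)[OF that] by (simp add: v_def t_def s_def norm_divide norm_mult prod_norm)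
  have cnj_eq: "cnj x = 1 / x" if "x \<in> A" for x
    using A(3)[OF that] by (metis divide_conv_cnj mult_1)
  \<comment> \<open>Degree 3 is reached by \<open>(a * x + b) * x^2\<close>, the numerator of
    \<open>x * v x\<close>.\<close>
  have lagrange: "(\<Sum>x\<in>A. poly q x / (\<Prod>y\<in>A - {x}. x - y)) = 0" if "degree q \<le> 3" for q
    using that A by (intro sum_poly_over_node_products_eq_0) auto
  have v0: "(\<Sum>x\<in>A. v x) = 0"
  proof -
    have "(\<Sum>x\<in>A. v x) = (\<Sum>x\<in>A. poly [:0, b, a:] x / (\<Prod>y\<in>A - {x}. x - y)) / of_real N"
      unfolding sum_divide_distrib by (intro sum.cong) (simp_all add: v_def algebra_simps)
    then show ?thesis by (subst (asm) lagrange) auto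
  qed
  have v1: "(\<Sum>x\<in>A. x * v x) = 0"
  proof -
    have "(\<Sum>x\<in>A. x * v x) = (\<Sum>x\<in>A. poly [:0, 0, b, a:] x / (\<Prod>y\<in>A - {x}. x - y)) / of_real N"
      unfolding sum_divide_distrib by (intro sum.cong) (simp_all add: v_def algebra_simps)
    then show ?thesis by (subst (asm) lagrange) auto
  qed
  have v2: "(\<Sum>x\<in>A. x * cnj (v x)) = 0"
  proof -
    have "cnj (\<Sum>x\<in>A. x * cnj (v x)) = (\<Sum>x\<in>A. poly [:b, a:] x / (\<Prod>y\<in>A - {x}. x - y)) / of_real N"
      unfolding sum_divide_distrib cnj_sum
    proof (intro sum.cong refl)
      fix x assume x: "x \<in> A"
      then have "x \<noteq> 0" using A(3) by fastforce
      then show "cnj (x * cnj (v x)) = poly [:b, a:] x / (\<Prod>y\<in>A - {x}. x - y) / of_real N"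
        using cnj_eq[OF x] by (simp add: v_def algebra_simps)
    qed
    also have "\<dots> = 0" by (subst lagrange) auto
    finally show ?thesis by (simp only: complex_cnj_zero_iff)
  qed
  have v3: "(\<Sum>x\<in>A. cnj (v x)) = 0" using v0 by (metis cnj_sum complex_cnj_zero)
  have sum_es: "(\<Sum>j<length es. f (es ! j)) = (\<Sum>x\<in>A. f x)" for f :: "complex \<Rightarrow> 'b::comm_monoid_add"
    using sum.reindex_bij_betw[OF bij_betw_nth[OF es(1) refl refl], of f] by (simp add: A_def)
  \<comment> \<open>Since \<open>cmod (v x) = t x\<close>, both rows have moduli
    \<open>sqrt (t x)\<close>.\<close>
  define \<alpha> where "\<alpha> i j = (if i = 0 then of_real (sqrt (t (es ! j)))
    else cnj (v (es ! j)) / of_real (sqrt (t (es ! j))))" for i j :: nat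
  have in_A: "es ! j \<in> A" if "j < length es" for j using that by (simp add: A_def)
  have vt: "of_real (sqrt (t x)) * (v x / of_real (sqrt (t x))) = v x"
    "of_real (sqrt (t x)) * (cnj (v x) / of_real (sqrt (t x))) = cnj (v x)" if "x \<in> A" for x
    using v_norm[OF that] by auto
  have norm_\<alpha>: "cmod (\<alpha> i j) = sqrt (t (es ! j))" if "j < length es" for i j
    using t_ge[of "es ! j"] v_norm[OF in_A[OF that]]
    by (simp add: \<alpha>_def norm_divide real_div_sqrt)
  have "(\<Sum>x\<in>A. of_real (t x) * (x - z)) = (\<Sum>x\<in>A. s x *\<^sub>R (x - z)) / of_real N"
    unfolding sum_divide_distrib by (intro sum.cong) (simp_all add: t_def scaleR_conv_of_real)
  also have "\<dots> = 0" using ab(2) by (simp add: s_def)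
  finally have "(\<Sum>x\<in>A. of_real (t x) * x) = of_real (\<Sum>x\<in>A. t x) * z"
    by (simp add: right_diff_distrib sum_subtractf sum_distrib_right)
  moreover have t1: "(\<Sum>x\<in>A. t x) = 1"
    using N by (simp add: t_def sum_divide_distrib[symmetric] N_def[symmetric])
  ultimately have tz: "z = (\<Sum>x\<in>A. of_real (t x) * x)" by simp
  have e01: "\<alpha> 0 j * cnj (\<alpha> 1 j) = v (es ! j)" and e10: "\<alpha> 1 j * cnj (\<alpha> 0 j) = cnj (v (es ! j))"
    if "j < length es" for j
    using vt[OF in_A[OF that]] by (simp_all add: \<alpha>_def mult.commute)
  have s01: "(\<Sum>j<length es. \<alpha> 0 j * cnj (\<alpha> 1 j)) = 0"
    using v0 by (subst sum.cong[OF refl e01]) (simp_all add: sum_es)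
  have s10: "(\<Sum>j<length es. \<alpha> 1 j * cnj (\<alpha> 0 j)) = 0"
    using v3 by (subst sum.cong[OF refl e10]) (simp_all add: sum_es[of "\<lambda>x. cnj (v x)"])
  have l01: "(\<Sum>j<length es. es ! j * \<alpha> 0 j * cnj (\<alpha> 1 j)) = 0"
  proof -
    have "(\<Sum>j<length es. es ! j * \<alpha> 0 j * cnj (\<alpha> 1 j)) = (\<Sum>j<length es. es ! j * v (es ! j))"
      by (intro sum.cong refl) (use e01 in \<open>simp add: mult.assoc\<close>)
    then show ?thesis using v1 sum_es[of "\<lambda>x. x * v x"] by simp
  qed
  have l10: "(\<Sum>j<length es. es ! j * \<alpha> 1 j * cnj (\<alpha> 0 j)) = 0"
  proof -
    have "(\<Sum>j<length es. es ! j * \<alpha> 1 j * cnj (\<alpha> 0 j)) = (\<Sum>j<length es. es ! j * cnj (v (es ! j)))"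
      by (intro sum.cong refl) (use e10 in \<open>simp add: mult.assoc\<close>)
    then show ?thesis using v2 sum_es[of "\<lambda>x. x * cnj (v x)"] by simp
  qed
  show "z \<in> Sigma_list 2 es"
    unfolding Sigma_list_def
  proof (intro CollectI exI[of _ "\<lambda>j. t (es ! j)"] exI[of _ \<alpha>] conjI)
    show "(\<Sum>j<length es. t (es ! j)) = 1" using t1 by (simp add: sum_es)
    show "z = (\<Sum>j<length es. of_real (t (es ! j)) * es ! j)"
      using tz by (simp add: sum_es[of "\<lambda>x. of_real (t x) * x"])
    show "\<forall>i<2. \<forall>i'<2. i \<noteq> i' \<longrightarrow>
        (\<Sum>j<length es. \<alpha> i j * cnj (\<alpha> i' j)) = 0 \<and>
        (\<Sum>j<length es. es ! j * \<alpha> i j * cnj (\<alpha> i' j)) = 0"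
      using s01 s10 l01 l10 by (auto simp: less_2_cases_iff)
  qed (use t_ge norm_\<alpha> in auto)
qed

section \<open>Adjoints, diagonalization and rank\<close>

lemma index_mult_mat_sum:
  assumes "A \<in> carrier_mat n m" "B \<in> carrier_mat m k" "i < n" "j < k"
  shows "(A * B) $$ (i, j) = (\<Sum>l<m. A $$ (i, l) * B $$ (l, j))"
  using assms by (simp add: scalar_prod_def atLeast0LessThan)

lemma mat_adjoint_carrier: "A \<in> carrier_mat n m \<Longrightarrow> mat_adjoint A \<in> carrier_mat m n"
  by (auto simp: mat_adjoint_def)

lemma index_mat_adjoint:
  fixes A :: "complex mat"
  assumes "A \<in> carrier_mat n m" "i < m" "j < n"
  shows "mat_adjoint A $$ (i, j) = cnj (A $$ (j, i))"
  using assms by (simp add: mat_adjoint_def mat_of_rows_index)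

lemma mat_adjoint_adjoint:
  fixes A :: "complex mat"
  assumes "A \<in> carrier_mat n m"
  shows "mat_adjoint (mat_adjoint A) = A"
proof (rule eq_matI)
  note A' = mat_adjoint_carrier[OF assms]
  note A'' = mat_adjoint_carrier[OF A']
  show "dim_row (mat_adjoint (mat_adjoint A)) = dim_row A"
    "dim_col (mat_adjoint (mat_adjoint A)) = dim_col A"
    using A'' assms by auto
  fix i j assume "i < dim_row A" "j < dim_col A"
  then show "mat_adjoint (mat_adjoint A) $$ (i, j) = A $$ (i, j)"
    using assms by (simp add: index_mat_adjoint[OF A'] index_mat_adjoint[OF assms])
qed

lemma mat_adjoint_mult:
  fixes A B :: "complex mat"
  assumes A: "A \<in> carrier_mat n m" and B: "B \<in> carrier_mat m k"
  shows "mat_adjoint (A * B) = mat_adjoint B * mat_adjoint A"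
proof (rule eq_matI)
  note AB = mult_carrier_mat[OF A B]
  note A' = mat_adjoint_carrier[OF A] and B' = mat_adjoint_carrier[OF B]
  show "dim_row (mat_adjoint (A * B)) = dim_row (mat_adjoint B * mat_adjoint A)"
    "dim_col (mat_adjoint (A * B)) = dim_col (mat_adjoint B * mat_adjoint A)"
    using mat_adjoint_carrier[OF AB] A' B' by auto
  fix i j assume "i < dim_row (mat_adjoint B * mat_adjoint A)" "j < dim_col (mat_adjoint B * mat_adjoint A)"
  then have ij: "i < k" "j < n" using A' B' by auto
  show "mat_adjoint (A * B) $$ (i, j) = (mat_adjoint B * mat_adjoint A) $$ (i, j)"
    using ij by (simp add: index_mat_adjoint[OF AB] index_mult_mat_sum[OF A B] index_mult_mat_sum[OF B' A']
        index_mat_adjoint[OF A] index_mat_adjoint[OF B] cnj_sum mult.commute)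
qed

definition diag_of_list :: "'a::zero list \<Rightarrow> 'a mat" where
  "diag_of_list xs = mat (length xs) (length xs) (\<lambda>(i, j). if i = j then xs ! i else 0)"

lemma diag_of_list_carrier: "length xs = n \<Longrightarrow> diag_of_list xs \<in> carrier_mat n n"
  by (auto simp: diag_of_list_def)

lemma index_diag_of_list_mult:
  fixes xs :: "'a::semiring_0 list"
  assumes "length xs = n" "A \<in> carrier_mat n m" "i < n" "j < m"
  shows "(diag_of_list xs * A) $$ (i, j) = xs ! i * A $$ (i, j)"
  unfolding index_mult_mat_sum[OF diag_of_list_carrier[OF assms(1)] assms(2-4)]
  using assms(1,3) by (simp add: diag_of_list_def if_distrib[of "\<lambda>x. x * _"] cong: if_cong)

lemma index_mult_diag_of_list:
  fixes xs :: "'a::semiring_0 list"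
  assumes "length xs = n" "A \<in> carrier_mat m n" "i < m" "j < n"
  shows "(A * diag_of_list xs) $$ (i, j) = A $$ (i, j) * xs ! j"
  unfolding index_mult_mat_sum[OF assms(2) diag_of_list_carrier[OF assms(1)] assms(3,4)]
  using assms(1,4) by (simp add: diag_of_list_def if_distrib[of "\<lambda>x. _ * x"] cong: if_cong)

lemma index_adjoint_mult_adjoint:
  fixes A B :: "complex mat"
  assumes "A \<in> carrier_mat n m" "B \<in> carrier_mat n k" "i < m" "j < k"
  shows "(mat_adjoint A * B) $$ (i, j) = (\<Sum>l<n. cnj (A $$ (l, i)) * B $$ (l, j))"
  using assms
  by (simp add: index_mult_mat_sum[OF mat_adjoint_carrier[OF assms(1)] assms(2)] index_mat_adjoint[OF assms(1)])

lemma unitary_diagonalization: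
  fixes U :: "complex mat"
  assumes U: "U \<in> carrier_mat n n" "unitary_mat U" and card: "card (spectrum U) = n"
  obtains V where "V \<in> carrier_mat n n" "mat_adjoint V * V = 1\<^sub>m n"
    "mat_adjoint V * U * V = diag_of_list (eigvals U)" "distinct (eigvals U)"
    "\<And>x. x \<in> set (eigvals U) \<Longrightarrow> cmod x = 1"
proof -
  define es where "es = eigvals U"
  have es: "length es = n" "set es = spectrum U"
    using U(1) by (simp_all add: es_def length_eigvals set_eigvals)
  have dist: "distinct es" using es card by (simp add: card_distinct)
  have "\<exists>v. eigenvector U v (es ! i)" if "i < n" for i
  proof -
    have "es ! i \<in> spectrum U" using that es by (metis nth_mem)
    then show ?thesis by (simp add: spectrum_def eigenvalue_def)
  qed
  then obtain v where v: "\<And>i. i < n \<Longrightarrow> eigenvector U (v i) (es ! i)" by metis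
  have v_carrier: "v i \<in> carrier_vec n" and v_ne: "v i \<noteq> 0\<^sub>v n"
    and Uv: "U *\<^sub>v v i = es ! i \<cdot>\<^sub>v v i" if "i < n" for i
    using v[OF that] U(1) by (auto simp: eigenvector_def)
  define N where "N i = (\<Sum>r<n. (cmod (v i $ r))\<^sup>2)" for i
  have N: "N i > 0" if i: "i < n" for i
  proof -
    obtain r where "r < n" "v i $ r \<noteq> 0"
      using v_ne[OF i] v_carrier[OF i] by (metis carrier_vecD eq_vecI index_zero_vec)
    then show ?thesis unfolding N_def by (intro sum_pos2[of _ r]) auto
  qed
  define V where "V = mat n n (\<lambda>(r, i). v i $ r / of_real (sqrt (N i)))"
  have V: "V \<in> carrier_mat n n" by (simp add: V_def)
  note V' = mat_adjoint_carrier[OF V] and D = diag_of_list_carrier[OF es(1)]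
  note UV = mult_carrier_mat[OF U(1) V] and VD = mult_carrier_mat[OF V D]
  define G where "G = mat_adjoint V * V"
  have G: "G \<in> carrier_mat n n" using V V' by (simp add: G_def)
  have UV_eq: "U * V = V * diag_of_list es"
  proof (rule eq_matI)
    fix r i assume "r < dim_row (V * diag_of_list es)" "i < dim_col (V * diag_of_list es)"
    then have ri: "r < n" "i < n" using VD by auto
    have "(\<Sum>l<n. U $$ (r, l) * v i $ l) = (U *\<^sub>v v i) $ r"
      using ri U(1) v_carrier[OF ri(2)] by (simp add: scalar_prod_def atLeast0LessThan)
    also have "\<dots> = es ! i * v i $ r" using ri v_carrier[OF ri(2)] by (simp add: Uv)
    finally show "(U * V) $$ (r, i) = (V * diag_of_list es) $$ (r, i)"
      unfolding index_mult_mat_sum[OF U(1) V ri] index_mult_diag_of_list[OF es(1) V ri]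
      using ri by (simp add: V_def sum_divide_distrib[symmetric] mult.commute)
  qed (use U(1) V D in auto)
  have G_diag: "G $$ (i, i) = 1" if "i < n" for i
  proof -
    have "G $$ (i, i) = of_real (\<Sum>l<n. (cmod (V $$ (l, i)))\<^sup>2)"
      using that unfolding G_def index_adjoint_mult_adjoint[OF V V that that] of_real_sum
      by (intro sum.cong refl) (simp only: complex_norm_square mult.commute)
    also have "(\<Sum>l<n. (cmod (V $$ (l, i)))\<^sup>2) = (\<Sum>l<n. (cmod (v i $ l))\<^sup>2 / N i)"
      using that N[OF that] by (intro sum.cong refl) (simp add: V_def norm_divide power_divide)
    also have "\<dots> = 1" using N[OF that] by (simp add: sum_divide_distrib[symmetric] N_def[symmetric])
    finally show ?thesis by simp
  qed
  have "mat_adjoint U * U = 1\<^sub>m n"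
    using U mat_adjoint_carrier[OF U(1)] by (simp add: unitary_mat_def inverts_mat_def)
  then have "G = mat_adjoint V * (mat_adjoint U * U) * V" using V' by (simp add: G_def)
  also have "\<dots> = mat_adjoint (U * V) * (U * V)"
    unfolding mat_adjoint_mult[OF U(1) V] using U(1) V V' mat_adjoint_carrier[OF U(1)]
    by (simp add: assoc_mult_mat[of _ n n _ n _ n])
  finally have GD: "G = mat_adjoint (V * diag_of_list es) * (V * diag_of_list es)" by (simp only: UV_eq)
  have G_eq: "G $$ (i, j) = cnj (es ! i) * es ! j * G $$ (i, j)" if ij: "i < n" "j < n" for i j
  proof -
    have "G $$ (i, j) = (\<Sum>l<n. cnj (V $$ (l, i) * es ! i) * (V $$ (l, j) * es ! j))"
      using ij by (subst GD) (simp add: index_adjoint_mult_adjoint[OF VD VD] index_mult_diag_of_list[OF es(1) V])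
    also have "\<dots> = cnj (es ! i) * es ! j * (\<Sum>l<n. cnj (V $$ (l, i)) * V $$ (l, j))"
      unfolding sum_distrib_left by (intro sum.cong) simp_all
    finally show ?thesis by (simp add: G_def index_adjoint_mult_adjoint[OF V V ij])
  qed
  have cnj1: "cnj (es ! i) * es ! i = 1" if "i < n" for i
    using G_eq[OF that that] G_diag[OF that] by simp
  have norm1: "cmod (es ! i) = 1" if "i < n" for i
    using cnj1[OF that] by (metis complex_mod_cnj mult.commute norm_mult norm_one norm_ge_zero mult_1
        abs_norm_cancel real_sqrt_abs2 real_sqrt_one)
  have G1: "G = 1\<^sub>m n"
  proof (rule eq_matI)
    fix i j assume "i < dim_row (1\<^sub>m n)" "j < dim_col (1\<^sub>m n)"
    then have ij: "i < n" "j < n" by auto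
    show "G $$ (i, j) = 1\<^sub>m n $$ (i, j)"
    proof (cases "i = j")
      case False
      have "G $$ (i, j) = 0"
      proof (rule ccontr)
        assume "G $$ (i, j) \<noteq> 0"
        then have "cnj (es ! i) * es ! j = 1" using G_eq[OF ij] by simp
        then have "es ! i = es ! j" using cnj1[OF ij(1)]
          by (metis mult.assoc mult.commute mult_1)
        then show False using False dist ij es(1) by (simp add: nth_eq_iff_index_eq)
      qed
      then show ?thesis using False ij by simp
    qed (use ij G_diag in auto)
  qed (use G in auto)
  have "mat_adjoint V * U * V = mat_adjoint V * (V * diag_of_list es)"
    using U(1) V V' by (simp add: UV_eq[symmetric] assoc_mult_mat[of _ n n _ n _ n])
  also have "\<dots> = G * diag_of_list es"
    using V V' D by (simp add: G_def assoc_mult_mat[of _ n n _ n _ n])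
  also have "\<dots> = diag_of_list es" using D by (simp add: G1)
  finally have "mat_adjoint V * U * V = diag_of_list es" .
  moreover have "cmod x = 1" if "x \<in> set es" for x
    using that norm1 es(1) by (auto simp: in_set_conv_nth)
  ultimately show ?thesis using that[of V] V G1 dist by (simp add: G_def es_def)
qed

lemma rank_mult_left_inverse:
  fixes A B :: "'a::field mat"
  assumes A: "A \<in> carrier_mat n k" and B: "B \<in> carrier_mat k n" and BA: "B * A = 1\<^sub>m k"
  shows "vec_space.rank n (A * B) = k"
proof -
  interpret vec_space "TYPE('a)" n .
  have AB: "A * B \<in> carrier_mat n n" using A B by simp
  have "col_space (A * B) = col_space A"
  proof
    show "col_space (A * B) \<subseteq> col_space A"
      unfolding col_space_eq[OF AB] col_space_eq[OF A] using A B
      by (auto simp: assoc_mult_mat_vec[of A n k B n])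
    show "col_space A \<subseteq> col_space (A * B)"
    proof
      fix y assume "y \<in> col_space A"
      then obtain x where x: "x \<in> carrier_vec k" "A *\<^sub>v x = y"
        unfolding col_space_eq[OF A] using A by auto
      have "(A * B) *\<^sub>v (A *\<^sub>v x) = A *\<^sub>v ((B * A) *\<^sub>v x)"
        using A B x(1) by (simp add: assoc_mult_mat_vec[of A n k B n] assoc_mult_mat_vec[of B k n A k])
      then have "(A * B) *\<^sub>v y = y" using x by (simp add: BA)
      then show "y \<in> col_space (A * B)"
        unfolding col_space_eq[OF AB] using A B x by auto
    qed
  qed
  then have "rank (A * B) = rank A" by (simp add: rank_def col_space_def)
  also have "\<dots> = k"
  proof (rule lin_indpt_full_rank[OF A])
    show dist: "distinct (cols A)"
      unfolding distinct_conv_nth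
    proof (intro allI impI notI)
      fix i j assume ij: "i < length (cols A)" "j < length (cols A)" "i \<noteq> j" "cols A ! i = cols A ! j"
      then have ij': "i < k" "j < k" "col A i = col A j" using A by auto
      have "(B * A) $$ (i, i) = (B * A) $$ (i, j)" using ij' A B by simp
      then show False using ij' ij(3) by (simp add: BA)
    qed
    show "lin_indpt (set (cols A))"
    proof (rule ccontr)
      assume "\<not> ?thesis"
      then obtain x where x: "x \<in> carrier_vec k" "x \<noteq> 0\<^sub>v k" "A *\<^sub>v x = 0\<^sub>v n"
        using lin_depE[OF A _ dist] by blast
      have "x = (B * A) *\<^sub>v x" using x by (simp add: BA)
      also have "\<dots> = B *\<^sub>v 0\<^sub>v n" using x A B by (simp add: assoc_mult_mat_vec[of B k n A k])
      also have "\<dots> = 0\<^sub>v k" using B by auto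
      finally show False using x by simp
    qed
  qed
  finally show ?thesis .
qed

lemma exists_in_range_with_zero_coordinate:
  fixes P R :: "'a::field mat"
  assumes P: "P \<in> carrier_mat n n" and R: "R \<in> carrier_mat n n"
    and rank: "vec_space.rank n P \<ge> 2" and m: "m < n"
  shows "\<exists>W \<in> carrier_mat n 1. P * W \<noteq> 0\<^sub>m n 1 \<and> (R * (P * W)) $$ (m, 0) = 0"
proof (rule ccontr)
  assume *: "\<not> ?thesis"
  define f where "f i = (R * P) $$ (m, i)" for i
  have comb: "P $$ (r, a) * f b = P $$ (r, b) * f a" if rab: "r < n" "a < n" "b < n" for r a b
  proof -
    define W where "W = mat n 1 (\<lambda>(i, _). (if i = a then f b else 0) - (if i = b then f a else 0))"
    have W: "W \<in> carrier_mat n 1" by (simp add: W_def)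
    have W_sum: "(\<Sum>i<n. g i * W $$ (i, 0)) = g a * f b - g b * f a" for g
      using rab by (simp add: W_def right_diff_distrib sum_subtractf if_distrib[of "\<lambda>x. _ * x"] cong: if_cong)
    have "(R * (P * W)) $$ (m, 0) = (R * P * W) $$ (m, 0)"
      using P R W by (simp add: assoc_mult_mat[of R n n P n W 1])
    also have "\<dots> = f a * f b - f b * f a"
      using index_mult_mat_sum[OF mult_carrier_mat[OF R P] W m] W_sum[of f] by (simp add: f_def)
    finally have "(R * (P * W)) $$ (m, 0) = 0" by simp
    then have "P * W = 0\<^sub>m n 1" using * W by blast
    then have "(P * W) $$ (r, 0) = 0" using rab by simp
    then show ?thesis
      using index_mult_mat_sum[OF P W rab(1)] W_sum[of "\<lambda>i. P $$ (r, i)"] by simp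
  qed
  have "vec_space.rank n P \<le> 1"
  proof (cases "\<exists>b<n. f b \<noteq> 0")
    case True
    then obtain b where b: "b < n" "f b \<noteq> 0" by blast
    show ?thesis
      by (rule vec_space.rank_le_1_product_entries[OF P, of "\<lambda>r. P $$ (r, b)" "\<lambda>c. f c / f b"])
        (use P comb b in \<open>simp add: field_simps\<close>)
  next
    case False
    have "P $$ (r, c) = 0" if rc: "r < n" "c < n" for r c
    proof -
      define W where "W = mat n 1 (\<lambda>(i, _). if i = c then 1 else (0::'a))"
      have W: "W \<in> carrier_mat n 1" by (simp add: W_def)
      have W_sum: "(\<Sum>i<n. g i * W $$ (i, 0)) = g c" for g
        using rc by (simp add: W_def if_distrib[of "\<lambda>x. _ * x"] cong: if_cong)
      have "(R * (P * W)) $$ (m, 0) = (R * P * W) $$ (m, 0)"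
        using P R W by (simp add: assoc_mult_mat[of R n n P n W 1])
      also have "\<dots> = f c"
        using index_mult_mat_sum[OF mult_carrier_mat[OF R P] W m] W_sum[of f] by (simp add: f_def)
      finally have "(R * (P * W)) $$ (m, 0) = 0" using False rc by simp
      then have "P * W = 0\<^sub>m n 1" using * W by blast
      then have "(P * W) $$ (r, 0) = 0" using rc by simp
      then show ?thesis
        using index_mult_mat_sum[OF P W rc(1)] W_sum[of "\<lambda>i. P $$ (r, i)"] by simp
    qed
    then show ?thesis
      by (intro vec_space.rank_le_1_product_entries[OF P, of "\<lambda>_. 0" "\<lambda>_. 0"]) (use P in auto)
  qed
  then show False using rank by simp
qed

section \<open>Comparison with the higher-rank numerical range\<close>

lemma adjoint_isometry_congruence:
  fixes V U C :: "complex mat"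
  assumes V: "V \<in> carrier_mat n n" and iso: "mat_adjoint V * V = 1\<^sub>m n"
    and U: "U \<in> carrier_mat n n" and C: "C \<in> carrier_mat n k"
  shows "mat_adjoint (V * C) * (V * C) = mat_adjoint C * C"
    and "mat_adjoint (V * C) * (U * (V * C)) = mat_adjoint C * ((mat_adjoint V * U * V) * C)"
proof -
  note V' = mat_adjoint_carrier[OF V] and C' = mat_adjoint_carrier[OF C]
  note VC = mult_carrier_mat[OF V C] and V'U = mult_carrier_mat[OF V' U]
  note UVC = mult_carrier_mat[OF U VC]
  show "mat_adjoint (V * C) * (V * C) = mat_adjoint C * C"
    unfolding mat_adjoint_mult[OF V C] assoc_mult_mat[OF C' V' VC]
      assoc_mult_mat[OF V' V C, symmetric] iso using C by simp
  show "mat_adjoint (V * C) * (U * (V * C)) = mat_adjoint C * ((mat_adjoint V * U * V) * C)"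
    unfolding mat_adjoint_mult[OF V C] assoc_mult_mat[OF C' V' UVC]
      assoc_mult_mat[OF V'U V C] assoc_mult_mat[OF V' U VC] ..
qed

lemma Sigma_list_subset_higher_rank_numerical_range:
  fixes U V :: "complex mat"
  assumes U: "U \<in> carrier_mat n n" and V: "V \<in> carrier_mat n n" and iso: "mat_adjoint V * V = 1\<^sub>m n"
    and diag: "mat_adjoint V * U * V = diag_of_list es" and es: "length es = n"
  shows "Sigma_list k es \<subseteq> higher_rank_numerical_range k U"
proof
  fix z assume "z \<in> Sigma_list k es"
  then obtain t \<alpha> where t: "\<And>j. j < n \<Longrightarrow> t j \<ge> (0::real)" "(\<Sum>j<n. t j) = 1"
    and z: "z = (\<Sum>j<n. of_real (t j) * es ! j)"
    and norm_\<alpha>: "\<And>i j. i < k \<Longrightarrow> j < n \<Longrightarrow> cmod (\<alpha> i j) = sqrt (t j)"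
    and orth: "\<And>i i'. i < k \<Longrightarrow> i' < k \<Longrightarrow> i \<noteq> i' \<Longrightarrow> (\<Sum>j<n. \<alpha> i j * cnj (\<alpha> i' j)) = 0"
      "\<And>i i'. i < k \<Longrightarrow> i' < k \<Longrightarrow> i \<noteq> i' \<Longrightarrow> (\<Sum>j<n. es ! j * \<alpha> i j * cnj (\<alpha> i' j)) = 0"
    unfolding Sigma_list_def es by blast
  define C where "C = mat n k (\<lambda>(j, i). \<alpha> i j)"
  have C: "C \<in> carrier_mat n k" by (simp add: C_def)
  have C_index: "C $$ (j, i) = \<alpha> i j" if "j < n" "i < k" for i j using that by (simp add: C_def)
  note C' = mat_adjoint_carrier[OF C] and D = diag_of_list_carrier[OF es]
  note DC = mult_carrier_mat[OF D C]
  have sq: "cnj (\<alpha> i j) * \<alpha> i j = of_real (t j)" if "i < k" "j < n" for i j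
    using norm_\<alpha>[OF that] t(1)[OF that(2)] complex_norm_square[of "\<alpha> i j"] by (simp add: mult.commute)
  have CC: "mat_adjoint C * C = 1\<^sub>m k"
  proof (rule eq_matI)
    fix i i' assume "i < dim_row (1\<^sub>m k)" "i' < dim_col (1\<^sub>m k)"
    then have ii: "i < k" "i' < k" by auto
    have "(mat_adjoint C * C) $$ (i, i') = (\<Sum>j<n. \<alpha> i' j * cnj (\<alpha> i j))"
      unfolding index_adjoint_mult_adjoint[OF C C ii]
      by (intro sum.cong) (use ii in \<open>simp_all add: C_index\<close>)
    also have "\<dots> = 1\<^sub>m k $$ (i, i')"
    proof (cases "i = i'")
      case True
      have "(\<Sum>j<n. \<alpha> i' j * cnj (\<alpha> i j)) = of_real (\<Sum>j<n. t j)"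
        unfolding of_real_sum by (intro sum.cong) (use sq ii True in \<open>simp_all add: mult.commute\<close>)
      then show ?thesis using ii True t(2) by simp
    qed (use ii orth in simp)
    finally show "(mat_adjoint C * C) $$ (i, i') = 1\<^sub>m k $$ (i, i')" .
  qed (use C C' in auto)
  have DC_index: "(diag_of_list es * C) $$ (j, i) = es ! j * \<alpha> i j" if "j < n" "i < k" for i j
    unfolding index_diag_of_list_mult[OF es C that] using that by (simp add: C_index)
  have CDC: "mat_adjoint C * (diag_of_list es * C) = z \<cdot>\<^sub>m 1\<^sub>m k"
  proof (rule eq_matI)
    fix i i' assume "i < dim_row (z \<cdot>\<^sub>m 1\<^sub>m k)" "i' < dim_col (z \<cdot>\<^sub>m 1\<^sub>m k)"
    then have ii: "i < k" "i' < k" by auto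
    have "(mat_adjoint C * (diag_of_list es * C)) $$ (i, i') = (\<Sum>j<n. es ! j * \<alpha> i' j * cnj (\<alpha> i j))"
      unfolding index_adjoint_mult_adjoint[OF C DC ii]
      by (intro sum.cong) (use ii in \<open>simp_all add: DC_index C_index\<close>)
    also have "\<dots> = (z \<cdot>\<^sub>m 1\<^sub>m k) $$ (i, i')"
    proof (cases "i = i'")
      case True
      have "(\<Sum>j<n. es ! j * \<alpha> i' j * cnj (\<alpha> i j)) = z"
        unfolding z by (intro sum.cong) (use sq ii True in \<open>simp_all add: mult.commute mult.left_commute\<close>)
      then show ?thesis using ii True by simp
    qed (use ii orth in simp)
    finally show "(mat_adjoint C * (diag_of_list es * C)) $$ (i, i') = (z \<cdot>\<^sub>m 1\<^sub>m k) $$ (i, i')" .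
  qed (use DC C' in auto)
  define A where "A = V * C"
  define A' where "A' = mat_adjoint A"
  have A: "A \<in> carrier_mat n k" using V C by (simp add: A_def)
  have A': "A' \<in> carrier_mat k n" unfolding A'_def by (rule mat_adjoint_carrier[OF A])
  have AA: "A' * A = 1\<^sub>m k"
    unfolding A'_def A_def adjoint_isometry_congruence(1)[OF V iso U C] by (rule CC)
  have AUA: "A' * (U * A) = z \<cdot>\<^sub>m 1\<^sub>m k"
    unfolding A'_def A_def adjoint_isometry_congruence(2)[OF V iso U C] diag by (rule CDC)
  define P where "P = A * A'"
  have P: "P \<in> carrier_mat n n" unfolding P_def by (rule mult_carrier_mat[OF A A'])
  note A'U = mult_carrier_mat[OF A' U]
  have "P * P = A * ((A' * A) * A')"
    unfolding P_def assoc_mult_mat[OF A' A A'] by (rule assoc_mult_mat[OF A A' P[unfolded P_def]])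
  then have "P * P = P" using A' by (simp add: AA P_def)
  moreover have "mat_adjoint P = P"
    unfolding P_def mat_adjoint_mult[OF A A'] unfolding A'_def mat_adjoint_adjoint[OF A] ..
  moreover have "P * U * P = z \<cdot>\<^sub>m P"
  proof -
    have "P * U * P = A * (A' * (U * A) * A')"
      unfolding P_def assoc_mult_mat[OF A A' U] assoc_mult_mat[OF A A'U mult_carrier_mat[OF A A']]
        assoc_mult_mat[OF A'U A A', symmetric] assoc_mult_mat[OF A' U A] ..
    also have "\<dots> = A * (z \<cdot>\<^sub>m A')"
      unfolding AUA using A' by (simp add: mult_smult_assoc_mat[OF one_carrier_mat A'])
    also have "\<dots> = z \<cdot>\<^sub>m P" unfolding P_def by (rule mult_smult_distrib[OF A A'])
    finally show ?thesis .
  qed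
  moreover have "vec_space.rank n P = k"
    unfolding P_def by (rule rank_mult_left_inverse[OF A A' AA])
  ultimately show "z \<in> higher_rank_numerical_range k U"
    unfolding higher_rank_numerical_range_def orthogonal_projection_def
    using P U by auto
qed

lemma higher_rank_numerical_range_subset_Omega_list:
  fixes U V :: "complex mat"
  assumes U: "U \<in> carrier_mat n n" and V: "V \<in> carrier_mat n n" and iso: "mat_adjoint V * V = 1\<^sub>m n"
    and diag: "mat_adjoint V * U * V = diag_of_list es" and es: "length es = n" and n: "n \<ge> 2"
  shows "higher_rank_numerical_range 2 U \<subseteq> Omega_list 2 es"
proof
  fix z assume "z \<in> higher_rank_numerical_range 2 U"
  then obtain P where P: "P \<in> carrier_mat n n" and PP: "P * P = P" and P': "mat_adjoint P = P"
    and rank: "vec_space.rank n P = 2" and PUP: "P * U * P = z \<cdot>\<^sub>m P"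
    using U by (auto simp: higher_rank_numerical_range_def orthogonal_projection_def)
  note V' = mat_adjoint_carrier[OF V] and D = diag_of_list_carrier[OF es]
  have iso': "V * mat_adjoint V = 1\<^sub>m n" using mat_mult_left_right_inverse[OF V' V iso] .
  have "z \<in> convex hull ((!) es ` S)" if S: "S \<subseteq> {..<n}" "card S = n - 2 + 1" for S
  proof -
    have "card ({..<n} - S) = 1"
      using S n by (simp add: card_Diff_subset finite_subset)
    then obtain m where m: "{..<n} - S = {m}" by (rule card_1_singletonE)
    then have mn: "m < n" by auto
    obtain W where W: "W \<in> carrier_mat n 1" "P * W \<noteq> 0\<^sub>m n 1" "(mat_adjoint V * (P * W)) $$ (m, 0) = 0"
      using exists_in_range_with_zero_coordinate[OF P V' _ mn] rank by auto
    define X where "X = P * W"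
    define Y where "Y = mat_adjoint V * X"
    have X: "X \<in> carrier_mat n 1" unfolding X_def by (rule mult_carrier_mat[OF P W(1)])
    have Y: "Y \<in> carrier_mat n 1" unfolding Y_def by (rule mult_carrier_mat[OF V' X])
    note X' = mat_adjoint_carrier[OF X] and DY = mult_carrier_mat[OF D Y] and UX = mult_carrier_mat[OF U X]
    have XY: "X = V * Y"
      unfolding Y_def assoc_mult_mat[OF V V' X, symmetric] iso' using X by simp
    have PX: "P * X = X"
      unfolding X_def assoc_mult_mat[OF P P W(1), symmetric] PP ..
    have X'P: "mat_adjoint X * P = mat_adjoint X"
      using mat_adjoint_mult[OF P X] by (simp add: PX P')
    have one: "0 < (1::nat)" by simp
    have "mat_adjoint Y * (diag_of_list es * Y) = mat_adjoint X * (U * X)"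
      unfolding XY adjoint_isometry_congruence(2)[OF V iso U Y] diag ..
    also have "\<dots> = mat_adjoint X * P * (U * X)" by (simp only: X'P)
    also have "\<dots> = mat_adjoint X * (P * (U * (P * X)))"
      unfolding PX by (rule assoc_mult_mat[OF X' P UX])
    also have "P * (U * (P * X)) = P * U * P * X"
      unfolding assoc_mult_mat[OF mult_carrier_mat[OF P U] P X]
        assoc_mult_mat[OF P U mult_carrier_mat[OF P X]] ..
    also have "\<dots> = z \<cdot>\<^sub>m X" unfolding PUP mult_smult_assoc_mat[OF P X] PX ..
    also have "mat_adjoint X * (z \<cdot>\<^sub>m X) = z \<cdot>\<^sub>m (mat_adjoint X * X)"
      by (rule mult_smult_distrib[OF X' X])
    also have "mat_adjoint X * X = mat_adjoint Y * Y"
      unfolding XY by (rule adjoint_isometry_congruence(1)[OF V iso U Y])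
    finally have "(mat_adjoint Y * (diag_of_list es * Y)) $$ (0, 0) = (z \<cdot>\<^sub>m (mat_adjoint Y * Y)) $$ (0, 0)"
      by simp
    then have "(\<Sum>l<n. cnj (Y $$ (l, 0)) * (diag_of_list es * Y) $$ (l, 0)) =
        z * (\<Sum>l<n. cnj (Y $$ (l, 0)) * Y $$ (l, 0))"
      unfolding index_adjoint_mult_adjoint[OF Y DY one one]
        index_adjoint_mult_adjoint[OF Y Y one one, symmetric]
      using mat_adjoint_carrier[OF Y] Y by simp
    moreover define a where "a l = (cmod (Y $$ (l, 0)))\<^sup>2" for l
    have a: "cnj (Y $$ (l, 0)) * Y $$ (l, 0) = of_real (a l)" for l
      unfolding a_def complex_norm_square by (rule mult.commute)
    have "cnj (Y $$ (l, 0)) * (diag_of_list es * Y) $$ (l, 0) = of_real (a l) * es ! l" if "l < n" for l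
      using index_diag_of_list_mult[OF es Y that one] by (simp add: a[symmetric])
    ultimately have az: "(\<Sum>l<n. of_real (a l) * es ! l) = z * of_real (\<Sum>l<n. a l)"
      by (simp add: a of_real_sum)
    have N: "(\<Sum>l<n. a l) > 0"
    proof -
      have "\<exists>l<n. Y $$ (l, 0) \<noteq> 0"
      proof (rule ccontr)
        assume "\<not> ?thesis"
        then have "Y = 0\<^sub>m n 1" using Y by (intro eq_matI) auto
        then have "X = 0\<^sub>m n 1" unfolding XY using V by simp
        then show False using W(2) by (simp add: X_def)
      qed
      then obtain l where "l < n" "Y $$ (l, 0) \<noteq> 0" by blast
      then show ?thesis by (intro sum_pos2[of _ l]) (auto simp: a_def)
    qed
    have am: "a m = 0" using W(3) by (simp add: a_def Y_def X_def)
    have sum_S: "(\<Sum>l<n. f l) = (\<Sum>l\<in>S. f l)" if "f m = 0" for f :: "nat \<Rightarrow> 'b::comm_monoid_add"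
      using S(1) m that by (intro sum.mono_neutral_right) auto
    have "z = (\<Sum>l<n. of_real (a l) * es ! l) / of_real (\<Sum>l<n. a l)"
      using az N by (simp add: eq_divide_eq del: of_real_sum)
    also have "\<dots> = (\<Sum>l<n. (a l / (\<Sum>l<n. a l)) *\<^sub>R es ! l)"
      unfolding sum_divide_distrib by (simp add: scaleR_conv_of_real)
    also have "\<dots> = (\<Sum>l\<in>S. (a l / (\<Sum>l<n. a l)) *\<^sub>R es ! l)" by (rule sum_S) (simp add: am)
    also have "\<dots> \<in> convex hull ((!) es ` S)"
    proof (rule convex_sum)
      show "finite S" using S(1) finite_subset by blast
      show "(\<Sum>l\<in>S. a l / (\<Sum>l<n. a l)) = 1"
        using N sum_S[of a] am by (simp add: sum_divide_distrib[symmetric])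
      show "0 \<le> a l / (\<Sum>l<n. a l)" for l using N by (simp add: a_def)
      show "es ! l \<in> convex hull ((!) es ` S)" if "l \<in> S" for l using that by (intro hull_inc) auto
    qed (rule convex_convex_hull)
    finally show ?thesis .
  qed
  then show "z \<in> Omega_list 2 es" by (auto simp: Omega_list_def es)
qed

theorem theorem6p4:
  fixes U :: "complex mat"
  assumes "U \<in> carrier_mat 5 5"
    and "unitary_mat U"
    and "card (spectrum U) = 5"
  shows "Omega_range 2 U = Sigma_range 2 U \<and> higher_rank_numerical_range 2 U = Omega_range 2 U"
proof -
  note es = length_eigvals[OF assms(1)]
  obtain V where V: "V \<in> carrier_mat 5 5" "mat_adjoint V * V = 1\<^sub>m 5"
      "mat_adjoint V * U * V = diag_of_list (eigvals U)"
    and dist: "distinct (eigvals U)" and norm: "\<And>x. x \<in> set (eigvals U) \<Longrightarrow> cmod x = 1"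
    by (rule unitary_diagonalization[OF assms]) blast
  have "Omega_range 2 U \<subseteq> Sigma_range 2 U"
    unfolding Omega_range_def Sigma_range_def by (rule Omega_list_subset_Sigma_list[OF dist es norm])
  moreover have "Sigma_range 2 U \<subseteq> higher_rank_numerical_range 2 U"
    unfolding Sigma_range_def
    by (rule Sigma_list_subset_higher_rank_numerical_range[OF assms(1) V es])
  moreover have "higher_rank_numerical_range 2 U \<subseteq> Omega_range 2 U"
    unfolding Omega_range_def
    by (rule higher_rank_numerical_range_subset_Omega_list[OF assms(1) V es]) simp
  ultimately show ?thesis by blast
qed

end
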